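(* Let $q,S$ be functions on positive integers such that for every $k$, every $k$-terminal network admits a flow sparsifier of quality $q(k)$ with at most $S(k)$ vertices. Then every $k$-terminal network $G$ whose underlying graph has treewidth $w$ has a flow sparsifier of quality $q(6w)$ with at most $k^4\cdot S(6w)$ vertices.
   Context: A $k$-terminal network $G=(V,E,c)$ is a finite connected undirected graph with nonnegative edge capacities and a set $T\subseteq V$ of $k$ terminals. A demand vector $\mathbf d\in\mathbb R_+^{\binom T2}$ assigns $d_{st}\ge0$ to each unordered pair of distinct terminals; it can be routed if a multicommodity flow simultaneously sends $d_{st}$ units between each pair with total flow on each edge at most its capacity. For nonzero $\mathbf d$, $\lambda_G(\mathbf d)=\sup\{\lambda\ge0:\lambda\mathbf d\text{ can be routed in }G\}$. A network $G'=(V',E',c')$ with $T\subseteq V'$ is a flow sparsifier of $G$ of quality $q\ge1$ if $\lambda_G(\mathbf d)\le\lambda_{G'}(\mathbf d)\le q\lambda_G(\mathbf d)$ for all nonzero $\mathbf d$. *)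

theory Defs
  imports Complex_Main "HOL-Library.Ramsey" "HOL-Library.Infinite_Typeclass"
begin

text \<open>
  Graphs are simple and undirected. An edge is a two-element set of vertices, and
  \<open>[A]\<^bsup>2\<^esup>\<close> (from \<^theory>\<open>HOL-Library.Ramsey\<close>) is the set of all two-element subsets of \<open>A\<close>.
\<close>

definition finite_graph :: "'v set \<Rightarrow> 'v set set \<Rightarrow> bool" where
  "finite_graph V E \<longleftrightarrow> finite V \<and> E \<subseteq> [V]\<^bsup>2\<^esup>"

definition connected_graph :: "'v set \<Rightarrow> 'v set set \<Rightarrow> bool" where
  "connected_graph V E \<longleftrightarrow> V \<noteq> {} \<and> (\<forall>u\<in>V. \<forall>v\<in>V. (u, v) \<in> {(x, y). {x, y} \<in> E}\<^sup>*)"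

definition is_cycle :: "'v set set \<Rightarrow> 'v list \<Rightarrow> bool" where
  "is_cycle E xs \<longleftrightarrow> 3 \<le> length xs \<and> distinct xs \<and>
     (\<forall>i<length xs. {xs ! i, xs ! (Suc i mod length xs)} \<in> E)"

definition tree_graph :: "'v set \<Rightarrow> 'v set set \<Rightarrow> bool" where
  "tree_graph V E \<longleftrightarrow> finite_graph V E \<and> connected_graph V E \<and> (\<nexists>xs. is_cycle E xs)"


text \<open>
  The tree \<open>(I, F)\<close> of a tree decomposition is finite, so taking its nodes in \<^typ>\<open>nat\<close>
  is no restriction. The last condition says that the nodes whose bag contains a given
  vertex induce a connected subgraph of the tree.
\<close>

definition tree_decomposition ::
    "'v set \<Rightarrow> 'v set set \<Rightarrow> nat set \<Rightarrow> nat set set \<Rightarrow> (nat \<Rightarrow> 'v set) \<Rightarrow> bool" where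
  "tree_decomposition V E I F B \<longleftrightarrow>
     tree_graph I F \<and>
     (\<Union>i\<in>I. B i) = V \<and>
     (\<forall>e\<in>E. \<exists>i\<in>I. e \<subseteq> B i) \<and>
     (\<forall>v\<in>V. connected_graph {i \<in> I. v \<in> B i} (F \<inter> [{i \<in> I. v \<in> B i}]\<^bsup>2\<^esup>))"

definition decomposition_width :: "nat set \<Rightarrow> (nat \<Rightarrow> 'v set) \<Rightarrow> nat" where
  "decomposition_width I B = (MAX i\<in>I. card (B i)) - 1"

definition treewidth :: "'v set \<Rightarrow> 'v set set \<Rightarrow> nat" where
  "treewidth V E =
     (LEAST w. \<exists>I F B. tree_decomposition V E I F B \<and> decomposition_width I B = w)"

lemma trivial_tree_decomposition:
  assumes "finite_graph V E"
  shows "tree_decomposition V E {0} {} (\<lambda>_. V)"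
  using assms
  by (auto simp: tree_decomposition_def tree_graph_def finite_graph_def connected_graph_def
      is_cycle_def nsets_def intro!: exI[of _ "0::nat"])


text \<open>The capacity function is only meaningful on the edges of the network.\<close>

record 'v network =
  verts :: "'v set"
  edges :: "'v set set"
  capacity :: "'v set \<Rightarrow> real"

definition network :: "'v network \<Rightarrow> bool" where
  "network G \<longleftrightarrow> finite_graph (verts G) (edges G) \<and> connected_graph (verts G) (edges G) \<and>
     (\<forall>e\<in>edges G. 0 \<le> capacity G e)"

definition terminal_network :: "nat \<Rightarrow> 'v network \<Rightarrow> 'v set \<Rightarrow> bool" where
  "terminal_network k G T \<longleftrightarrow> network G \<and> T \<subseteq> verts G \<and> card T = k"

text \<open>
  \<open>g u v\<close> is the amount of flow sent across the edge \<open>{u, v}\<close> in the direction from \<open>u\<close>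
  to \<open>v\<close>. Conservation at \<open>t\<close> with net inflow \<open>x\<close> follows from the other conditions.
\<close>

definition st_flow :: "'v network \<Rightarrow> 'v \<Rightarrow> 'v \<Rightarrow> real \<Rightarrow> ('v \<Rightarrow> 'v \<Rightarrow> real) \<Rightarrow> bool" where
  "st_flow G s t x g \<longleftrightarrow>
     (\<forall>u v. 0 \<le> g u v) \<and>
     (\<forall>u v. {u, v} \<notin> edges G \<longrightarrow> g u v = 0) \<and>
     (\<forall>v\<in>verts G - {s, t}. (\<Sum>u\<in>verts G. g u v) = (\<Sum>u\<in>verts G. g v u)) \<and>
     (\<Sum>u\<in>verts G. g s u) - (\<Sum>u\<in>verts G. g u s) = x"

text \<open>
  A demand vector is a function on unordered pairs of terminals; its values outside
  \<open>[T]\<^bsup>2\<^esup>\<close> are irrelevant. The commodity of a pair may be oriented either way, which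
  makes no difference since reversing a flow does not change its load on the edges.
\<close>

definition demand :: "'v set \<Rightarrow> ('v set \<Rightarrow> real) \<Rightarrow> bool" where
  "demand T d \<longleftrightarrow> (\<forall>p\<in>[T]\<^bsup>2\<^esup>. 0 \<le> d p)"

definition nonzero_demand :: "'v set \<Rightarrow> ('v set \<Rightarrow> real) \<Rightarrow> bool" where
  "nonzero_demand T d \<longleftrightarrow> demand T d \<and> (\<exists>p\<in>[T]\<^bsup>2\<^esup>. d p \<noteq> 0)"

definition routable :: "'v network \<Rightarrow> 'v set \<Rightarrow> ('v set \<Rightarrow> real) \<Rightarrow> bool" where
  "routable G T d \<longleftrightarrow>
     (\<exists>f. (\<forall>p\<in>[T]\<^bsup>2\<^esup>. \<exists>s t. p = {s, t} \<and> st_flow G s t (d p) (f p)) \<and>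
          (\<forall>u v. {u, v} \<in> edges G \<longrightarrow>
             (\<Sum>p\<in>[T]\<^bsup>2\<^esup>. f p u v + f p v u) \<le> capacity G {u, v}))"

definition throughput :: "'v network \<Rightarrow> 'v set \<Rightarrow> ('v set \<Rightarrow> real) \<Rightarrow> real" where
  "throughput G T d = Sup {l. 0 \<le> l \<and> routable G T (\<lambda>p. l * d p)}"

definition flow_sparsifier :: "real \<Rightarrow> 'v network \<Rightarrow> 'v set \<Rightarrow> 'v network \<Rightarrow> bool" where
  "flow_sparsifier q G T G' \<longleftrightarrow>
     1 \<le> q \<and> network G' \<and> T \<subseteq> verts G' \<and>
     (\<forall>d. nonzero_demand T d \<longrightarrow>
        throughput G T d \<le> throughput G' T d \<and> throughput G' T d \<le> q * throughput G T d)"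


text \<open>
  For a nonzero demand vector the supremum in \<^const>\<open>throughput\<close> ranges over a nonempty set that is
  bounded above, so the real-valued \<^const>\<open>Sup\<close> is the actual supremum.
\<close>

lemma throughput_set_nonempty:
  assumes "network G"
  shows "0 \<in> {l. 0 \<le> l \<and> routable G T (\<lambda>p. l * d p)}"
proof -
  have "\<exists>s t. p = {s, t}" if "p \<in> [T]\<^bsup>2\<^esup>" for p
    using that by (auto simp: nsets_def card_2_iff)
  then show ?thesis
    using assms
    by (auto simp: routable_def st_flow_def network_def intro!: exI[of _ "\<lambda>_ _ _. 0"])
qed

lemma throughput_set_bdd_above:
  assumes G: "network G" and T: "T \<subseteq> verts G" and d: "nonzero_demand T d"
  shows "bdd_above {l. 0 \<le> l \<and> routable G T (\<lambda>p. l * d p)}"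
proof -
  obtain p where p: "p \<in> [T]\<^bsup>2\<^esup>" "d p > 0"
    using d by (force simp: nonzero_demand_def demand_def)
  define V where "V = verts G"
  define c where "c u v = (if {u, v} \<in> edges G then capacity G {u, v} else 0)" for u v
  define M where "M = (\<Sum>s\<in>V. \<Sum>u\<in>V. c s u)"
  have fin: "finite V" using G by (simp add: network_def finite_graph_def V_def)
  have finp: "finite ([T]\<^bsup>2\<^esup>)"
    using fin T finite_imp_finite_nsets finite_subset V_def by metis
  have c0: "0 \<le> c u v" for u v using G by (auto simp: c_def network_def)
  have "l \<le> M / d p" if r: "routable G T (\<lambda>p. l * d p)" for l
  proof -
    obtain f where f: "\<forall>p\<in>[T]\<^bsup>2\<^esup>. \<exists>s t. p = {s, t} \<and> st_flow G s t (l * d p) (f p)"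
      and cap: "\<forall>u v. {u, v} \<in> edges G \<longrightarrow>
                  (\<Sum>p\<in>[T]\<^bsup>2\<^esup>. f p u v + f p v u) \<le> capacity G {u, v}"
      using r unfolding routable_def by blast
    obtain s t where st: "p = {s, t}" "st_flow G s t (l * d p) (f p)" using f p by blast
    have nn: "0 \<le> f p' u v" if "p' \<in> [T]\<^bsup>2\<^esup>" for p' u v
      using f that by (auto simp: st_flow_def)
    have sV: "s \<in> V" using st(1) p(1) T by (auto simp: nsets_def V_def)
    have le: "f p s u \<le> c s u" for u
    proof (cases "{s, u} \<in> edges G")
      case True
      have "f p s u \<le> f p s u + f p u s" using nn[OF p(1)] by simp
      also have "\<dots> \<le> (\<Sum>p\<in>[T]\<^bsup>2\<^esup>. f p s u + f p u s)"
        by (rule member_le_sum[OF p(1)]) (auto intro: finp add_nonneg_nonneg nn)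
      also have "\<dots> \<le> c s u" using cap True by (simp add: c_def)
      finally show ?thesis .
    next
      case False
      then show ?thesis using st(2) by (simp add: st_flow_def c_def)
    qed
    have "l * d p = (\<Sum>u\<in>V. f p s u) - (\<Sum>u\<in>V. f p u s)"
      using st(2) by (simp add: st_flow_def V_def)
    also have "\<dots> \<le> (\<Sum>u\<in>V. f p s u)" using nn[OF p(1)] by (simp add: sum_nonneg)
    also have "\<dots> \<le> (\<Sum>u\<in>V. c s u)" by (intro sum_mono le)
    also have "\<dots> \<le> M"
      unfolding M_def by (rule member_le_sum[OF sV]) (auto intro: fin sum_nonneg c0)
    finally show ?thesis using p(2) by (simp add: field_simps)
  qed
  then show ?thesis by (intro bdd_aboveI[of _ "M / d p"]) simp
qed

end

theory Submission
  imports Defs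
begin

text \<open>
  Demands and capacities are both weights on pairs of vertices, and ``the demands \<open>d\<close> can be routed
  within the capacities \<open>c\<close>'' is a transitive, additive relation. If \<open>d\<close> is routed in a union of
  pieces \<open>c\<^sub>i\<close>, a vertex that lies in one piece only and carries no demand can be eliminated: the flow
  through it is recorded as new weights between its neighbours, which that piece can route. Doing so
  for all inner vertices leaves weights \<open>\<delta>\<^sub>i\<close> on the boundaries of the pieces such that \<open>\<delta>\<^sub>i\<close> is routed in
  \<open>c\<^sub>i\<close> and \<open>d\<close> is routed in the sum of the \<open>\<delta>\<^sub>i\<close>. Hence replacing every piece by a sparsifier with
  respect to its boundary yields a sparsifier of the whole network.

  For the pieces, mark in the tree of the decomposition one node for each terminal. At most \<open>k - 1\<close>
  branching nodes cut the tree into parts that are each attached to at most two of the branching nodes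
  and terminals. Grouping the parts by what they are attached to gives at most \<open>4 k\<^sup>2\<close> pieces whose
  boundaries consist of at most two bags. If \<open>k \<le> 6 w\<close>, the whole network is a single piece.
\<close>

section \<open>Routability as a relation between weights on ordered pairs\<close>

text \<open>A flow of the whole network may cross a piece many times, with all commodities mixed,
  whereas a sparsifier of the piece is only promised to serve demands between its boundary vertices.
  Eliminating inner vertices turns the use of a piece into exactly such demands. All pieces lose the
  same factor \<open>q\<close> and routing is linear, so the losses do not multiply; exchanging
  pieces and sparsifiers gives the other inequality. Elimination produces unsymmetric weights, hence
  ordered pairs.

  Parts of the tree are grouped because their number alone is not bounded in \<open>k\<close>:
  arbitrarily many unmarked subtrees may hang off one branching node, while merging parts with the
  same attachments does not enlarge the boundary. The constant 6 stems from two bags of at most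
  \<open>w + 1 \<le> 3 * w\<close> vertices. The estimate \<open>4 * k\<^sup>2 \<le> k ^ 4\<close>
  requires \<open>2 \<le> k\<close>; a single terminal falls under the case of one piece.\<close>

definition chi :: "'v \<times> 'v \<Rightarrow> 'v \<Rightarrow> real" where
  "chi e x = of_bool (fst e = x) - of_bool (snd e = x)"

text \<open>
  \<open>f p e\<close> is the flow of commodity \<open>p\<close> across the arc \<open>e\<close>; an undirected edge appears as two arcs that
  both have its full capacity, and an undirected demand as two commodities.
\<close>

definition routing ::
    "'v set \<Rightarrow> ('v \<times> 'v \<Rightarrow> real) \<Rightarrow> ('v \<times> 'v \<Rightarrow> real) \<Rightarrow> ('v \<times> 'v \<Rightarrow> 'v \<times> 'v \<Rightarrow> real) \<Rightarrow> bool" where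
  "routing U d c f \<longleftrightarrow>
     (\<forall>p\<in>U \<times> U. \<forall>e\<in>U \<times> U. 0 \<le> f p e) \<and>
     (\<forall>p\<in>U \<times> U. \<forall>x. (\<Sum>e\<in>U \<times> U. f p e * chi e x) = d p * chi p x) \<and>
     (\<forall>e\<in>U \<times> U. (\<Sum>p\<in>U \<times> U. f p e) \<le> c e)"

definition routes :: "'v set \<Rightarrow> ('v \<times> 'v \<Rightarrow> real) \<Rightarrow> ('v \<times> 'v \<Rightarrow> real) \<Rightarrow> bool" where
  "routes U d c \<longleftrightarrow> (\<exists>f. routing U d c f)"

lemma routingD:
  assumes "routing U d c f"
  shows "\<And>p e. p \<in> U \<times> U \<Longrightarrow> e \<in> U \<times> U \<Longrightarrow> 0 \<le> f p e"
    and "\<And>p x. p \<in> U \<times> U \<Longrightarrow> (\<Sum>e\<in>U \<times> U. f p e * chi e x) = d p * chi p x"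
    and "\<And>e. e \<in> U \<times> U \<Longrightarrow> (\<Sum>p\<in>U \<times> U. f p e) \<le> c e"
  using assms unfolding routing_def by blast+

lemma routingI:
  assumes "\<And>p e. p \<in> U \<times> U \<Longrightarrow> e \<in> U \<times> U \<Longrightarrow> 0 \<le> f p e"
    and "\<And>p x. p \<in> U \<times> U \<Longrightarrow> (\<Sum>e\<in>U \<times> U. f p e * chi e x) = d p * chi p x"
    and "\<And>e. e \<in> U \<times> U \<Longrightarrow> (\<Sum>p\<in>U \<times> U. f p e) \<le> c e"
  shows "routing U d c f"
  using assms unfolding routing_def by blast

lemma routing_le_capacity:
  assumes "routing U d c f" "finite U" "p \<in> U \<times> U" "e \<in> U \<times> U"
  shows "f p e \<le> c e"
proof -
  have "f p e \<le> (\<Sum>p\<in>U \<times> U. f p e)"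
    using assms routingD(1)[OF assms(1)] by (intro member_le_sum) auto
  then show ?thesis using routingD(3)[OF assms(1,4)] by linarith
qed

lemma routes_mono:
  assumes "routes U d c" "\<And>e. e \<in> U \<times> U \<Longrightarrow> c e \<le> c' e"
  shows "routes U d c'"
proof -
  obtain f where f: "routing U d c f" using assms(1) unfolding routes_def by blast
  have "routing U d c' f"
    using order_trans[OF routingD(3)[OF f] assms(2)] by (intro routingI routingD[OF f])
  then show ?thesis unfolding routes_def by blast
qed

lemma routes_cong:
  assumes "\<And>e. e \<in> U \<times> U \<Longrightarrow> d e = d' e" "\<And>e. e \<in> U \<times> U \<Longrightarrow> c e = c' e"
  shows "routes U d c \<longleftrightarrow> routes U d' c'"
  using assms unfolding routes_def routing_def by simp

lemma routes_scale:
  assumes "routes U d c" "0 \<le> r"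
  shows "routes U (\<lambda>p. r * d p) (\<lambda>e. r * c e)"
proof -
  obtain f where f: "routing U d c f" using assms(1) unfolding routes_def by blast
  have "routing U (\<lambda>p. r * d p) (\<lambda>e. r * c e) (\<lambda>p e. r * f p e)"
    using routingD[OF f] assms(2)
    by (intro routingI) (auto simp: mult.assoc sum_distrib_left[symmetric] mult_left_mono)
  then show ?thesis unfolding routes_def by blast
qed

lemma routes_scale_le:
  assumes "routes U d c" "0 \<le> r" "r \<le> 1" "\<And>e. e \<in> U \<times> U \<Longrightarrow> 0 \<le> c e"
  shows "routes U (\<lambda>p. r * d p) c"
  by (rule routes_mono[OF routes_scale[OF assms(1,2)]])
     (use assms(2-4) in \<open>simp add: mult_left_le_one_le\<close>)

lemma routes_add:
  assumes "routes U d c" "routes U d' c'"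
  shows "routes U (\<lambda>p. d p + d' p) (\<lambda>e. c e + c' e)"
proof -
  obtain f where f: "routing U d c f" using assms(1) unfolding routes_def by blast
  obtain g where g: "routing U d' c' g" using assms(2) unfolding routes_def by blast
  have "routing U (\<lambda>p. d p + d' p) (\<lambda>e. c e + c' e) (\<lambda>p e. f p e + g p e)"
    using routingD[OF f] routingD[OF g]
    by (intro routingI) (auto simp: distrib_right sum.distrib add_mono)
  then show ?thesis unfolding routes_def by blast
qed

lemma routes_zero:
  assumes "\<And>p. p \<in> U \<times> U \<Longrightarrow> d p = 0" "\<And>e. e \<in> U \<times> U \<Longrightarrow> 0 \<le> c e"
  shows "routes U d c"
  unfolding routes_def
  by (rule exI[of _ "\<lambda>_ _. 0"], rule routingI) (use assms in auto)

lemma routes_refl: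
  assumes "finite U" "\<And>p. p \<in> U \<times> U \<Longrightarrow> 0 \<le> d p"
  shows "routes U d d"
proof -
  have "routing U d d (\<lambda>p e. if p = e then d p else 0)"
    using assms by (intro routingI) (auto simp: if_distrib[of "\<lambda>x. x * _"] cong: if_cong)
  then show ?thesis unfolding routes_def by blast
qed

lemma routes_sum:
  assumes "finite A" "\<And>i. i \<in> A \<Longrightarrow> routes U (d i) (c i)"
  shows "routes U (\<lambda>p. \<Sum>i\<in>A. d i p) (\<lambda>e. \<Sum>i\<in>A. c i e)"
  using assms
proof (induction A rule: finite_induct)
  case empty
  then show ?case by (auto intro: routes_zero)
next
  case (insert i A)
  then show ?case using routes_add[of U "d i" "c i"] by simp
qed

section \<open>Reversing, composing, restricting and renaming routings\<close>

lemma chi_swap: "chi (prod.swap e) x = - chi e x"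
  by (simp add: chi_def)

lemma sum_swap_Times: "(\<Sum>e\<in>U \<times> U. g (prod.swap e)) = (\<Sum>e\<in>U \<times> U. g e)"
  by (rule sum.reindex_bij_witness[of _ prod.swap prod.swap]) auto

text \<open>Reversing all commodities and arcs negates both sides of the conservation law. Averaging
  with the reversal will later make boundary weights symmetric.\<close>

lemma routes_swap:
  assumes "routes U d c"
  shows "routes U (d \<circ> prod.swap) (c \<circ> prod.swap)"
proof -
  obtain f where f: "routing U d c f" using assms(1) unfolding routes_def by blast
  have "routing U (d \<circ> prod.swap) (c \<circ> prod.swap) (\<lambda>p e. f (prod.swap p) (prod.swap e))"
  proof (rule routingI)
    show "0 \<le> f (prod.swap p) (prod.swap e)" if "p \<in> U \<times> U" "e \<in> U \<times> U" for p e
      using that by (intro routingD(1)[OF f]) auto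
    show "(\<Sum>e\<in>U \<times> U. f (prod.swap p) (prod.swap e) * chi e x) = (d \<circ> prod.swap) p * chi p x"
      if "p \<in> U \<times> U" for p x
    proof -
      have "(\<Sum>e\<in>U \<times> U. f (prod.swap p) (prod.swap e) * chi e x) =
            (\<Sum>e\<in>U \<times> U. - (f (prod.swap p) (prod.swap e) * chi (prod.swap e) x))"
        by (simp add: chi_swap)
      also have "\<dots> = (\<Sum>e\<in>U \<times> U. - (f (prod.swap p) e * chi e x))"
        by (rule sum_swap_Times)
      also have "\<dots> = - (d (prod.swap p) * chi (prod.swap p) x)"
        using routingD(2)[OF f, of "prod.swap p" x] that by (auto simp: sum_negf)
      finally show ?thesis by (simp add: chi_swap)
    qed
    show "(\<Sum>p\<in>U \<times> U. f (prod.swap p) (prod.swap e)) \<le> (c \<circ> prod.swap) e" if "e \<in> U \<times> U" for e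
      using routingD(3)[OF f, of "prod.swap e"] that sum_swap_Times[of "\<lambda>p. f p (prod.swap e)" U]
      by auto
  qed
  then show ?thesis unfolding routes_def by blast
qed

text \<open>An arc \<open>a\<close> of the middle layer is itself a demand \<open>c a\<close> that
  \<open>h\<close> routes within \<open>e\<close>. A commodity using \<open>f p a\<close> of it
  takes the fraction \<open>f p a / c a\<close> of that routing, and the fractions of all
  commodities add up to at most 1.\<close>

lemma routes_trans:
  assumes U: "finite U" and dc: "routes U d c" and ce: "routes U c e"
  shows "routes U d e"
proof -
  obtain f where f: "routing U d c f" using dc unfolding routes_def by blast
  obtain h where h: "routing U c e h" using ce unfolding routes_def by blast
  define k where "k p y = (\<Sum>a\<in>U \<times> U. f p a / c a * h a y)" for p y
  have c0: "0 \<le> c a" if "a \<in> U \<times> U" for a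
    using routing_le_capacity[OF f U that that] routingD(1)[OF f that that] by linarith
  \<comment> \<open>\<open>c a = 0\<close> forces \<open>f p a = 0\<close>, so the convention
    \<open>x / 0 = 0\<close> gives the right value.\<close>
  have fz: "f p a / c a * c a = f p a" if "p \<in> U \<times> U" "a \<in> U \<times> U" for p a
    using routing_le_capacity[OF f U that] routingD(1)[OF f that] by auto
  have "routing U d e k"
  proof (rule routingI)
    show "0 \<le> k p y" if "p \<in> U \<times> U" "y \<in> U \<times> U" for p y
      unfolding k_def using that c0 routingD(1)[OF f] routingD(1)[OF h]
      by (intro sum_nonneg mult_nonneg_nonneg divide_nonneg_nonneg) auto
    show "(\<Sum>y\<in>U \<times> U. k p y * chi y x) = d p * chi p x" if "p \<in> U \<times> U" for p x
    proof -
      have "(\<Sum>y\<in>U \<times> U. k p y * chi y x) =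
            (\<Sum>a\<in>U \<times> U. \<Sum>y\<in>U \<times> U. f p a / c a * (h a y * chi y x))"
        unfolding k_def sum_distrib_right by (subst sum.swap) (simp add: mult.assoc)
      also have "\<dots> = (\<Sum>a\<in>U \<times> U. f p a / c a * (c a * chi a x))"
        using routingD(2)[OF h] by (intro sum.cong refl) (simp only: sum_distrib_left[symmetric])
      also have "\<dots> = (\<Sum>a\<in>U \<times> U. f p a * chi a x)"
        by (intro sum.cong refl) (metis fz that mult.assoc)
      finally show ?thesis using routingD(2)[OF f that] by simp
    qed
    show "(\<Sum>p\<in>U \<times> U. k p y) \<le> e y" if y: "y \<in> U \<times> U" for y
    proof -
      have "(\<Sum>p\<in>U \<times> U. k p y) = (\<Sum>a\<in>U \<times> U. (\<Sum>p\<in>U \<times> U. f p a) / c a * h a y)"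
        unfolding k_def by (subst sum.swap) (simp only: sum_distrib_right sum_divide_distrib)
      also have "\<dots> \<le> (\<Sum>a\<in>U \<times> U. 1 * h a y)"
      proof (intro sum_mono mult_right_mono)
        fix a assume a: "a \<in> U \<times> U"
        show "(\<Sum>p\<in>U \<times> U. f p a) / c a \<le> 1"
          using routingD(3)[OF f a] c0[OF a] by (auto simp: divide_le_eq_1)
        show "0 \<le> h a y" using routingD(1)[OF h a y] .
      qed
      also have "\<dots> \<le> e y" using routingD(3)[OF h y] by simp
      finally show ?thesis .
    qed
  qed
  then show ?thesis unfolding routes_def by blast
qed

text \<open>Arcs of capacity 0 carry no flow, and void commodities can be given none, so routings
  restrict and extend by zero. This allows networks on different vertex sets to be compared inside
  one ambient \<open>U\<close>.\<close>

lemma routes_superset_iff: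
  assumes U: "finite U" "V \<subseteq> U"
    and c: "\<And>e. e \<in> U \<times> U - V \<times> V \<Longrightarrow> c e = 0" and d: "\<And>e. e \<in> U \<times> U - V \<times> V \<Longrightarrow> d e = 0"
  shows "routes U d c \<longleftrightarrow> routes V d c"
proof
  have sub: "V \<times> V \<subseteq> U \<times> U" and fin: "finite (U \<times> U)" using U by auto
  show "routes V d c" if r: "routes U d c"
  proof -
    obtain f where f: "routing U d c f" using r unfolding routes_def by blast
    have "routing V d c f"
    proof (rule routingI)
      show "0 \<le> f p e" if "p \<in> V \<times> V" "e \<in> V \<times> V" for p e
        using that sub by (intro routingD(1)[OF f]) auto
      show "(\<Sum>e\<in>V \<times> V. f p e * chi e x) = d p * chi p x" if p: "p \<in> V \<times> V" for p x
      proof -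
        have "f p e = 0" if e: "e \<in> U \<times> U - V \<times> V" for e
          using routingD(1)[OF f, of p e] routing_le_capacity[OF f U(1), of p e] c[OF e] p e sub
          by fastforce
        then have "(\<Sum>e\<in>V \<times> V. f p e * chi e x) = (\<Sum>e\<in>U \<times> U. f p e * chi e x)"
          by (intro sum.mono_neutral_left fin sub) auto
        then show ?thesis using routingD(2)[OF f] p sub by auto
      qed
      show "(\<Sum>p\<in>V \<times> V. f p e) \<le> c e" if e: "e \<in> V \<times> V" for e
      proof -
        have "(\<Sum>p\<in>V \<times> V. f p e) \<le> (\<Sum>p\<in>U \<times> U. f p e)"
          using e sub routingD(1)[OF f] by (intro sum_mono2 fin sub) auto
        then show ?thesis using routingD(3)[OF f, of e] e sub by fastforce
      qed
    qed
    then show ?thesis unfolding routes_def by blast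
  qed
  show "routes U d c" if r: "routes V d c"
  proof -
    obtain f where f: "routing V d c f" using r unfolding routes_def by blast
    define g where "g p e = (if p \<in> V \<times> V \<and> e \<in> V \<times> V then f p e else 0)" for p e
    have "routing U d c g"
    proof (rule routingI)
      show "0 \<le> g p e" for p e
        using routingD(1)[OF f] by (auto simp: g_def)
      show "(\<Sum>e\<in>U \<times> U. g p e * chi e x) = d p * chi p x" if p: "p \<in> U \<times> U" for p x
      proof (cases "p \<in> V \<times> V")
        case True
        have "(\<Sum>e\<in>U \<times> U. g p e * chi e x) = (\<Sum>e\<in>V \<times> V. f p e * chi e x)"
          using True by (intro sum.mono_neutral_cong_right fin sub) (auto simp: g_def)
        then show ?thesis using routingD(2)[OF f True] by simp
      next
        case False
        then show ?thesis using d[of p] p by (simp add: g_def)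
      qed
      show "(\<Sum>p\<in>U \<times> U. g p e) \<le> c e" if e: "e \<in> U \<times> U" for e
      proof (cases "e \<in> V \<times> V")
        case True
        have "(\<Sum>p\<in>U \<times> U. g p e) = (\<Sum>p\<in>V \<times> V. f p e)"
          using True by (intro sum.mono_neutral_cong_right fin sub) (auto simp: g_def)
        then show ?thesis using routingD(3)[OF f True] by simp
      next
        case False
        then show ?thesis using c[of e] e by (simp add: g_def)
      qed
    qed
    then show ?thesis unfolding routes_def by blast
  qed
qed

lemma routes_rename:
  assumes r: "bij_betw r X Y" and "routes X d c"
    and d: "\<And>x y. x \<in> X \<Longrightarrow> y \<in> X \<Longrightarrow> d' (r x, r y) = d (x, y)"
    and c: "\<And>x y. x \<in> X \<Longrightarrow> y \<in> X \<Longrightarrow> c' (r x, r y) = c (x, y)"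
  shows "routes Y d' c'"
proof -
  obtain f where f: "routing X d c f" using assms(2) unfolding routes_def by blast
  define s where "s = inv_into X r"
  define s2 where "s2 = map_prod s s"
  have s: "bij_betw s Y X" unfolding s_def using r by (rule bij_betw_inv_into)
  have s2: "bij_betw s2 (Y \<times> Y) (X \<times> X)" unfolding s2_def using s s by (rule bij_betw_map_prod)
  have rs: "r (s y) = y" if "y \<in> Y" for y
    unfolding s_def using r that by (rule bij_betw_inv_into_right)
  have sX: "s2 p \<in> X \<times> X" if "p \<in> Y \<times> Y" for p using s2 that by (meson bij_betwE)
  have chi: "chi (s2 e) (s x) = chi e x" if "e \<in> Y \<times> Y" "x \<in> Y" for e x
    using that rs by (auto simp: chi_def s2_def) metis+
  have dd: "d (s2 p) = d' p" "c (s2 p) = c' p" if "p \<in> Y \<times> Y" for p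
    using that sX[OF that] d[of "s (fst p)" "s (snd p)"] c[of "s (fst p)" "s (snd p)"] rs
    by (auto simp: s2_def)
  have "routing Y d' c' (\<lambda>p e. f (s2 p) (s2 e))"
  proof (rule routingI)
    show "0 \<le> f (s2 p) (s2 e)" if "p \<in> Y \<times> Y" "e \<in> Y \<times> Y" for p e
      using that by (intro routingD(1)[OF f] sX)
    show "(\<Sum>e\<in>Y \<times> Y. f (s2 p) (s2 e) * chi e x) = d' p * chi p x" if p: "p \<in> Y \<times> Y" for p x
    proof (cases "x \<in> Y")
      case True
      have "(\<Sum>e\<in>Y \<times> Y. f (s2 p) (s2 e) * chi e x) =
            (\<Sum>e\<in>Y \<times> Y. f (s2 p) (s2 e) * chi (s2 e) (s x))"
        using True chi by (intro sum.cong) auto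
      also have "\<dots> = (\<Sum>e\<in>X \<times> X. f (s2 p) e * chi e (s x))"
        by (rule sum.reindex_bij_betw[OF s2])
      finally show ?thesis using routingD(2)[OF f sX[OF p]] chi[OF p True] dd[OF p] by simp
    next
      case False
      then have "chi e x = 0" if "e \<in> Y \<times> Y" for e using that by (auto simp: chi_def)
      then show ?thesis using p by simp
    qed
    show "(\<Sum>p\<in>Y \<times> Y. f (s2 p) (s2 e)) \<le> c' e" if e: "e \<in> Y \<times> Y" for e
      using routingD(3)[OF f sX[OF e]] dd[OF e]
        sum.reindex_bij_betw[OF s2, of "\<lambda>p. f p (s2 e)"] by simp
  qed
  then show ?thesis unfolding routes_def by blast
qed

section \<open>Eliminating vertices\<close>

text \<open>\<open>chi e\<close> is the signed incidence vector of the arc \<open>e\<close>: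
  \<open>+1\<close> at the tail, \<open>-1\<close> at the head, zero for a loop. The sum is
  therefore a net outflow.\<close>

lemma sum_chi:
  assumes "finite U" "x \<in> U"
  shows "(\<Sum>e\<in>U \<times> U. g e * chi e x) = (\<Sum>u\<in>U. g (x, u)) - (\<Sum>u\<in>U. g (u, x))"
proof -
  have "(\<Sum>e\<in>U \<times> U. g e * chi e x) =
        (\<Sum>a\<in>U. \<Sum>b\<in>U. g (a, b) * of_bool (a = x)) - (\<Sum>a\<in>U. \<Sum>b\<in>U. g (a, b) * of_bool (b = x))"
    by (simp add: sum.cartesian_product chi_def right_diff_distrib sum_subtractf split_def)
  also have "(\<Sum>a\<in>U. \<Sum>b\<in>U. g (a, b) * of_bool (b = x)) = (\<Sum>u\<in>U. g (u, x))"
    using assms by (intro sum.cong refl) (simp add: of_bool_def if_distrib cong: if_cong)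
  also have "(\<Sum>a\<in>U. \<Sum>b\<in>U. g (a, b) * of_bool (a = x)) = (\<Sum>u\<in>U. g (x, u))"
    using assms by (subst sum.swap, intro sum.cong refl) (simp add: of_bool_def if_distrib cong: if_cong)
  finally show ?thesis .
qed

lemma chi_eq_0: "p \<in> U \<times> U \<Longrightarrow> x \<notin> U \<Longrightarrow> chi p x = 0"
  by (auto simp: chi_def)

text \<open>The flow through \<open>v\<close> is short-cut into direct arcs from predecessors to
  successors. The total \<open>\<delta>\<close> of the shortcuts is sufficient, since it replaces
  all arcs at \<open>v\<close>, and affordable, since it can be sent back through \<open>v\<close>
  within the old capacities there. That it lives on neighbours of \<open>v\<close> later confines it
  to a single piece.\<close>

lemma routes_eliminate:
  assumes U: "finite U" and v: "v \<in> U" and r: "routes U d c"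
    and d0: "\<And>x. x \<in> U \<Longrightarrow> d (x, v) = 0 \<and> d (v, x) = 0"
  obtains \<delta> where "\<And>e. e \<in> U \<times> U \<Longrightarrow> 0 \<le> \<delta> e"
    and "routes U d (\<lambda>e. (if fst e = v \<or> snd e = v then 0 else c e) + \<delta> e)"
    and "routes U \<delta> (\<lambda>e. if (fst e = v) \<noteq> (snd e = v) then c e else 0)"
    and "\<And>x y. x \<in> U \<Longrightarrow> y \<in> U \<Longrightarrow> \<delta> (x, y) \<noteq> 0 \<Longrightarrow> x \<noteq> v \<and> y \<noteq> v \<and> c (x, v) \<noteq> 0 \<and> c (v, y) \<noteq> 0"
proof -
  obtain f where f: "routing U d c f" using r unfolding routes_def by blast
  note f0 = routingD(1)[OF f]
  define W where "W = U - {v}"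
  have W: "finite W" "U = insert v W" "v \<notin> W" using U v by (auto simp: W_def)
  define F where "F p = (\<Sum>x\<in>W. f p (x, v))" for p
  have dv: "d p * chi p v = 0" if "p \<in> U \<times> U" for p
    using that d0 by (cases p) (auto simp: chi_def)
  \<comment> \<open>Flow on the loop at \<open>v\<close> counts as both inflow and outflow and
    cancels.\<close>
  have F_out: "(\<Sum>y\<in>W. f p (v, y)) = F p" if p: "p \<in> U \<times> U" for p
    using sum_chi[OF U v, of "f p"] routingD(2)[OF f p, of v] dv[OF p] W
    by (simp add: F_def)
  have F_in0: "f p (x, v) = 0" if "F p = 0" "p \<in> U \<times> U" "x \<in> W" for p x
    using that W f0 sum_nonneg_eq_0_iff[of W "\<lambda>x. f p (x, v)"] by (auto simp: F_def)
  have F_out0: "f p (v, y) = 0" if "F p = 0" "p \<in> U \<times> U" "y \<in> W" for p y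
    using that W f0 F_out[of p] sum_nonneg_eq_0_iff[of W "\<lambda>y. f p (v, y)"] by auto
  have F0: "0 \<le> F p" if "p \<in> U \<times> U" for p
    using that W f0 by (auto simp: F_def intro!: sum_nonneg)
  \<comment> \<open>The flow does not determine which incoming unit continues on which outgoing arc.
    Splitting in proportion gives row sums \<open>f p (x, v)\<close> and column sums
    \<open>f p (v, y)\<close>; if \<open>F p = 0\<close>, both are zero, as is the quotient.\<close>
  define \<theta> where "\<theta> p e = (if e \<in> W \<times> W then f p (fst e, v) * f p (v, snd e) / F p else 0)" for p e
  have \<theta>0: "0 \<le> \<theta> p e" if "p \<in> U \<times> U" for p e
    using that f0 F0 W by (auto simp: \<theta>_def)
  have \<theta>_out: "(\<Sum>y\<in>W. \<theta> p (x, y)) = f p (x, v)" if "p \<in> U \<times> U" "x \<in> W" for p x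
  proof -
    have "(\<Sum>y\<in>W. \<theta> p (x, y)) = f p (x, v) * (\<Sum>y\<in>W. f p (v, y)) / F p"
      using that(2) unfolding \<theta>_def sum_distrib_left sum_divide_distrib by (intro sum.cong) auto
    then show ?thesis using F_out[OF that(1)] F_in0[OF _ that] by (cases "F p = 0") simp_all
  qed
  have \<theta>_in: "(\<Sum>x\<in>W. \<theta> p (x, y)) = f p (v, y)" if "p \<in> U \<times> U" "y \<in> W" for p y
  proof -
    have "(\<Sum>x\<in>W. \<theta> p (x, y)) = (\<Sum>x\<in>W. f p (x, v)) * f p (v, y) / F p"
      using that(2) unfolding \<theta>_def sum_distrib_right sum_divide_distrib by (intro sum.cong) auto
    then show ?thesis using F_out0[OF _ that] by (cases "F p = 0") (simp_all add: F_def[symmetric])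
  qed
  define \<delta> where "\<delta> e = (\<Sum>p\<in>U \<times> U. \<theta> p e)" for e
  have \<delta>0: "0 \<le> \<delta> e" for e unfolding \<delta>_def using \<theta>0 by (intro sum_nonneg) auto
  have \<delta>W: "e \<in> W \<times> W" if "\<delta> e \<noteq> 0" for e
  proof (rule ccontr)
    assume "e \<notin> W \<times> W"
    then have "\<delta> e = 0" by (auto simp: \<delta>_def \<theta>_def)
    with that show False ..
  qed
  have \<delta>_out: "(\<Sum>y\<in>U. \<delta> (x, y)) \<le> c (x, v)" if x: "x \<in> W" for x
  proof -
    have "\<delta> (x, v) = 0" using \<delta>W W by blast
    then have "(\<Sum>y\<in>U. \<delta> (x, y)) = (\<Sum>y\<in>W. \<delta> (x, y))" using W by simp
    also have "\<dots> = (\<Sum>p\<in>U \<times> U. \<Sum>y\<in>W. \<theta> p (x, y))"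
      unfolding \<delta>_def by (rule sum.swap)
    also have "\<dots> = (\<Sum>p\<in>U \<times> U. f p (x, v))" using \<theta>_out x by (intro sum.cong) auto
    also have "\<dots> \<le> c (x, v)" using x W by (intro routingD(3)[OF f]) auto
    finally show ?thesis .
  qed
  have \<delta>_in: "(\<Sum>x\<in>U. \<delta> (x, y)) \<le> c (v, y)" if y: "y \<in> W" for y
  proof -
    have "\<delta> (v, y) = 0" using \<delta>W W by blast
    then have "(\<Sum>x\<in>U. \<delta> (x, y)) = (\<Sum>x\<in>W. \<delta> (x, y))" using W by simp
    also have "\<dots> = (\<Sum>p\<in>U \<times> U. \<Sum>x\<in>W. \<theta> p (x, y))"
      unfolding \<delta>_def by (rule sum.swap)
    also have "\<dots> = (\<Sum>p\<in>U \<times> U. f p (v, y))" using \<theta>_in y by (intro sum.cong) auto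
    also have "\<dots> \<le> c (v, y)" using y W by (intro routingD(3)[OF f]) auto
    finally show ?thesis .
  qed
  show thesis
  proof (rule that)
    show "0 \<le> \<delta> e" for e by (rule \<delta>0)
    show "x \<noteq> v \<and> y \<noteq> v \<and> c (x, v) \<noteq> 0 \<and> c (v, y) \<noteq> 0"
      if xy: "x \<in> U" "y \<in> U" "\<delta> (x, y) \<noteq> 0" for x y
    proof -
      have "x \<in> W" "y \<in> W" using \<delta>W[OF xy(3)] by auto
      moreover have "\<delta> (x, y) \<le> (\<Sum>y\<in>U. \<delta> (x, y))" "\<delta> (x, y) \<le> (\<Sum>x\<in>U. \<delta> (x, y))"
        using xy U \<delta>0 member_le_sum[of y U "\<lambda>y. \<delta> (x, y)"] member_le_sum[of x U "\<lambda>x. \<delta> (x, y)"]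
        by auto
      ultimately show ?thesis using \<delta>_out[of x] \<delta>_in[of y] \<delta>0[of "(x, y)"] xy(3) W(3) by force
    qed
    have "routing U d (\<lambda>e. (if fst e = v \<or> snd e = v then 0 else c e) + \<delta> e)
        (\<lambda>p e. (if e \<in> W \<times> W then f p e else 0) + \<theta> p e)"
    proof (rule routingI)
      show "0 \<le> (if e \<in> W \<times> W then f p e else 0) + \<theta> p e" if "p \<in> U \<times> U" "e \<in> U \<times> U" for p e
        using f0[OF that] \<theta>0[OF that(1)] by simp
      show "(\<Sum>e\<in>U \<times> U. ((if e \<in> W \<times> W then f p e else 0) + \<theta> p e) * chi e x) = d p * chi p x"
        if p: "p \<in> U \<times> U" for p x
      proof -
        consider "x \<in> W" | "x = v" | "x \<notin> U" using W by blast
        then show ?thesis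
        proof cases
          case 1
          then have x: "x \<in> U" using W by auto
          have z: "\<theta> p (x, v) = 0" "\<theta> p (v, x) = 0" using W by (auto simp: \<theta>_def)
          have ins: "(\<Sum>u\<in>U. g u) = g v + (\<Sum>u\<in>W. g u)" for g :: "'a \<Rightarrow> real"
            using W by simp
          have "(\<Sum>u\<in>U. f p (x, u)) - (\<Sum>u\<in>U. f p (u, x)) = d p * chi p x"
            using routingD(2)[OF f p, of x] unfolding sum_chi[OF U x] .
          then show ?thesis
            unfolding sum_chi[OF U x] ins
            using 1 W(3) z \<theta>_out[OF p 1] \<theta>_in[OF p 1] by (simp add: sum.distrib)
        next
          case 2
          have "((if e \<in> W \<times> W then f p e else 0) + \<theta> p e) * chi e x = 0" for e
            using 2 W(3) by (auto simp: \<theta>_def chi_def)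
          then have "(\<Sum>e\<in>U \<times> U. ((if e \<in> W \<times> W then f p e else 0) + \<theta> p e) * chi e x) = 0"
            by (intro sum.neutral) blast
          then show ?thesis using dv[OF p] 2 by (simp only:)
        next
          case 3
          then have "(\<Sum>e\<in>U \<times> U. ((if e \<in> W \<times> W then f p e else 0) + \<theta> p e) * chi e x) = 0"
            using chi_eq_0 by (intro sum.neutral) fastforce
          then show ?thesis using chi_eq_0[OF p 3] by (simp only: mult_zero_right)
        qed
      qed
      show "(\<Sum>p\<in>U \<times> U. (if e \<in> W \<times> W then f p e else 0) + \<theta> p e)
          \<le> (if fst e = v \<or> snd e = v then 0 else c e) + \<delta> e" if e: "e \<in> U \<times> U" for e
        using routingD(3)[OF f e] e W by (auto simp: sum.distrib \<delta>_def)
    qed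
    then show "routes U d (\<lambda>e. (if fst e = v \<or> snd e = v then 0 else c e) + \<delta> e)"
      unfolding routes_def by blast
    \<comment> \<open>A shortcut \<open>(x, y)\<close> is sent along \<open>(x, v)\<close> and
      \<open>(v, y)\<close>, whose incidence vectors telescope at \<open>v\<close>.\<close>
    have "routing U \<delta> (\<lambda>e. if (fst e = v) \<noteq> (snd e = v) then c e else 0)
        (\<lambda>p e. \<delta> p * (of_bool (e = (fst p, v)) + of_bool (e = (v, snd p))))"
    proof (rule routingI)
      show "0 \<le> \<delta> p * (of_bool (e = (fst p, v)) + of_bool (e = (v, snd p)))" for p e
        using \<delta>0 by simp
      show "(\<Sum>e\<in>U \<times> U. \<delta> p * (of_bool (e = (fst p, v)) + of_bool (e = (v, snd p))) * chi e x)
          = \<delta> p * chi p x" if p: "p \<in> U \<times> U" for p x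
      proof -
        have m: "(fst p, v) \<in> U \<times> U" "(v, snd p) \<in> U \<times> U" using p v by auto
        have s: "(\<Sum>e\<in>U \<times> U. of_bool (e = a) * chi e x) = chi a x" if "a \<in> U \<times> U" for a
          using that U by (simp add: of_bool_def if_distrib[of "\<lambda>x. x * _"] cong: if_cong)
        have "(\<Sum>e\<in>U \<times> U. \<delta> p * (of_bool (e = (fst p, v)) + of_bool (e = (v, snd p))) * chi e x)
           = \<delta> p * (chi (fst p, v) x + chi (v, snd p) x)"
          by (simp only: mult.assoc sum_distrib_left[symmetric] distrib_right sum.distrib s[OF m(1)] s[OF m(2)])
        also have "chi (fst p, v) x + chi (v, snd p) x = chi p x" by (simp add: chi_def)
        finally show ?thesis .
      qed
      show "(\<Sum>p\<in>U \<times> U. \<delta> p * (of_bool (e = (fst p, v)) + of_bool (e = (v, snd p))))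
          \<le> (if (fst e = v) \<noteq> (snd e = v) then c e else 0)" if e: "e \<in> U \<times> U" for e
      proof -
        obtain a b where ab: "e = (a, b)" "a \<in> U" "b \<in> U" using e by auto
        have z: "\<delta> (v, y) = 0" "\<delta> (y, v) = 0" for y using \<delta>W[of "(v, y)"] \<delta>W[of "(y, v)"] W by auto
        have 1: "(\<Sum>p\<in>U \<times> U. \<delta> p * of_bool (e = (fst p, v))) = of_bool (b = v) * (\<Sum>y\<in>U. \<delta> (a, y))"
          unfolding sum.cartesian_product' using ab U
          by (subst sum.swap) (auto simp: of_bool_def if_distrib cong: if_cong)
        have 2: "(\<Sum>p\<in>U \<times> U. \<delta> p * of_bool (e = (v, snd p))) = of_bool (a = v) * (\<Sum>x\<in>U. \<delta> (x, b))"
          unfolding sum.cartesian_product' using ab U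
          by (auto simp: of_bool_def if_distrib cong: if_cong)
        have "a \<in> W" if "a \<noteq> v" using that ab W by auto
        moreover have "b \<in> W" if "b \<noteq> v" using that ab W by auto
        ultimately show ?thesis
          using \<delta>_out[of a] \<delta>_in[of b] ab(1) z
          unfolding distrib_left sum.distrib 1 2
          by (cases "a = v"; cases "b = v") simp_all
      qed
    qed
    then show "routes U \<delta> (\<lambda>e. if (fst e = v) \<noteq> (snd e = v) then c e else 0)"
      unfolding routes_def by blast
  qed
qed

text \<open>Induction on the set \<open>W\<close> of vertices to eliminate. Since \<open>v\<close>
  lies in at most one \<open>X i\<close>, every shortcut over \<open>v\<close> has both ends in that
  \<open>X i\<close> and is added to the weights of this piece, whose old weights at
  \<open>v\<close> pay for it. Transitivity chains these replacements.\<close>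

lemma routes_split:
  assumes U: "finite U" and A: "finite A" and W: "finite W" "W \<subseteq> U"
    and r: "routes U d (\<lambda>e. \<Sum>i\<in>A. c i e)"
    and c0: "\<And>i e. i \<in> A \<Longrightarrow> e \<in> U \<times> U \<Longrightarrow> 0 \<le> c i e"
    and supp: "\<And>i x y. i \<in> A \<Longrightarrow> x \<in> U \<Longrightarrow> y \<in> U \<Longrightarrow> c i (x, y) \<noteq> 0 \<Longrightarrow> x \<in> X i \<and> y \<in> X i"
    and uniq: "\<And>v i j. v \<in> W \<Longrightarrow> i \<in> A \<Longrightarrow> j \<in> A \<Longrightarrow> v \<in> X i \<Longrightarrow> v \<in> X j \<Longrightarrow> i = j"
    and d0: "\<And>x y. x \<in> W \<Longrightarrow> y \<in> U \<Longrightarrow> d (x, y) = 0 \<and> d (y, x) = 0"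
  shows "\<exists>\<delta>. (\<forall>i\<in>A. (\<forall>e\<in>U \<times> U. 0 \<le> \<delta> i e) \<and> routes U (\<delta> i) (c i) \<and>
            (\<forall>x\<in>U. \<forall>y\<in>U. \<delta> i (x, y) \<noteq> 0 \<longrightarrow> x \<in> X i - W \<and> y \<in> X i - W)) \<and>
          routes U d (\<lambda>e. \<Sum>i\<in>A. \<delta> i e)"
  using W r c0 supp uniq d0
proof (induction W arbitrary: c X rule: finite_induct)
  case empty
  have "routes U (c i) (c i)" if "i \<in> A" for i
    using empty that by (intro routes_refl[OF U]) auto
  then show ?case using empty by (intro exI[of _ c]) auto
next
  case (insert v W)
  note c0 = insert.prems(3) and supp = insert.prems(4) and uniq = insert.prems(5)
  have v: "v \<in> U" using insert.prems by auto
  obtain \<delta> where \<delta>0: "\<And>e. e \<in> U \<times> U \<Longrightarrow> 0 \<le> \<delta> e"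
    and \<delta>1: "routes U d (\<lambda>e. (if fst e = v \<or> snd e = v then 0 else \<Sum>i\<in>A. c i e) + \<delta> e)"
    and \<delta>2: "routes U \<delta> (\<lambda>e. if (fst e = v) \<noteq> (snd e = v) then \<Sum>i\<in>A. c i e else 0)"
    and \<delta>3: "\<And>x y. x \<in> U \<Longrightarrow> y \<in> U \<Longrightarrow> \<delta> (x, y) \<noteq> 0 \<Longrightarrow>
        x \<noteq> v \<and> y \<noteq> v \<and> (\<Sum>i\<in>A. c i (x, v)) \<noteq> 0 \<and> (\<Sum>i\<in>A. c i (v, y)) \<noteq> 0"
    by (rule routes_eliminate[OF U v insert.prems(2)]) (use insert.prems(6) in blast)+
  have \<delta>X: "\<exists>i\<in>A. v \<in> X i \<and> x \<in> X i \<and> y \<in> X i" if xy: "x \<in> U" "y \<in> U" "\<delta> (x, y) \<noteq> 0" for x y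
  proof -
    obtain i where i: "i \<in> A" "c i (x, v) \<noteq> 0" using \<delta>3[OF xy] by (meson sum.neutral)
    obtain j where j: "j \<in> A" "c j (v, y) \<noteq> 0" using \<delta>3[OF xy] by (meson sum.neutral)
    have "i = j" using supp[OF i(1) _ _ i(2)] supp[OF j(1) _ _ j(2)] xy v uniq i j by blast
    then show ?thesis using supp[OF i(1) _ _ i(2)] supp[OF j(1) _ _ j(2)] xy v i by blast
  qed
  define b where "b i e = (if fst e = v \<or> snd e = v then 0 else c i e)" for i e
  define c' where "c' i e = b i e + (if v \<in> X i then \<delta> e else 0)" for i e
  have b0: "0 \<le> b i e" if "i \<in> A" "e \<in> U \<times> U" for i e using c0[OF that] by (simp add: b_def)
  have c'0: "0 \<le> c' i e" if "i \<in> A" "e \<in> U \<times> U" for i e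
    using b0[OF that] \<delta>0[OF that(2)] by (simp add: c'_def)
  have rc: "routes U (c' i) (c i)" if i: "i \<in> A" for i
  proof (cases "v \<in> X i")
    case True
    have "routes U (c' i) (\<lambda>e. b i e + (if (fst e = v) \<noteq> (snd e = v) then \<Sum>i\<in>A. c i e else 0))"
      using routes_add[OF routes_refl[OF U] \<delta>2] b0[OF i] True by (simp add: c'_def[abs_def])
    then show ?thesis
    proof (rule routes_mono)
      fix e assume e: "e \<in> U \<times> U"
      obtain x y where xy: "e = (x, y)" "x \<in> U" "y \<in> U" using e by auto
      \<comment> \<open>The fact \<open>\<delta>2\<close> charges the total weight of the arcs at
        \<open>v\<close>; all of it belongs to piece \<open>i\<close>.\<close>
      have "(\<Sum>j\<in>A. c j e) = c i e" if "x = v \<or> y = v"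
      proof -
        have "c j e = 0" if j: "j \<in> A - {i}" for j
          using supp[of j x y] uniq[of v i j] True i j xy \<open>x = v \<or> y = v\<close> by auto
        then show ?thesis using sum.remove[OF A i, of "\<lambda>j. c j e"] by simp
      qed
      then show "b i e + (if (fst e = v) \<noteq> (snd e = v) then \<Sum>i\<in>A. c i e else 0) \<le> c i e"
        using c0[OF i e] xy by (auto simp: b_def)
    qed
  next
    case False
    have "routes U (c' i) (c' i)" using c'0[OF i] by (intro routes_refl[OF U])
    then show ?thesis
      by (rule routes_mono) (use False c0[OF i] in \<open>auto simp: c'_def b_def\<close>)
  qed
  \<comment> \<open>Supports shrink to \<open>X i - {v}\<close>, so that in the end they avoid all
    of \<open>insert v W\<close>.\<close>
  have "\<exists>\<delta>. (\<forall>i\<in>A. (\<forall>e\<in>U \<times> U. 0 \<le> \<delta> i e) \<and> routes U (\<delta> i) (c' i) \<and>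
            (\<forall>x\<in>U. \<forall>y\<in>U. \<delta> i (x, y) \<noteq> 0 \<longrightarrow> x \<in> (X i - {v}) - W \<and> y \<in> (X i - {v}) - W)) \<and>
          routes U d (\<lambda>e. \<Sum>i\<in>A. \<delta> i e)"
  proof (rule insert.IH)
    show "W \<subseteq> U" using insert.prems by auto
    show "routes U d (\<lambda>e. \<Sum>i\<in>A. c' i e)"
      using \<delta>1
    proof (rule routes_mono)
      fix e assume e: "e \<in> U \<times> U"
      \<comment> \<open>A nonzero shortcut is credited to a piece containing \<open>v\<close>; if
        there is none, there are no shortcuts.\<close>
      have "\<delta> e \<le> (\<Sum>i\<in>A. if v \<in> X i then \<delta> e else 0)"
      proof (cases "\<delta> e = 0")
        case False
        then obtain i where i: "i \<in> A" "v \<in> X i" using \<delta>X[of "fst e" "snd e"] e by auto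
        have "(if v \<in> X i then \<delta> e else 0) \<le> (\<Sum>i\<in>A. if v \<in> X i then \<delta> e else 0)"
          using \<delta>0[OF e] by (intro member_le_sum i A) auto
        then show ?thesis using i by simp
      qed (simp add: sum_nonneg)
      moreover have "(if fst e = v \<or> snd e = v then 0 else \<Sum>i\<in>A. c i e) = (\<Sum>i\<in>A. b i e)"
        by (simp add: b_def)
      ultimately show "(if fst e = v \<or> snd e = v then 0 else \<Sum>i\<in>A. c i e) + \<delta> e \<le> (\<Sum>i\<in>A. c' i e)"
        by (simp add: c'_def sum.distrib)
    qed
    show "0 \<le> c' i e" if "i \<in> A" "e \<in> U \<times> U" for i e using c'0 that .
    show "x \<in> X i - {v} \<and> y \<in> X i - {v}"
      if i: "i \<in> A" and xy: "x \<in> U" "y \<in> U" and n: "c' i (x, y) \<noteq> 0" for i x y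
    proof (cases "b i (x, y) = 0")
      case True
      then have "v \<in> X i" "\<delta> (x, y) \<noteq> 0" using n by (auto simp: c'_def split: if_splits)
      then show ?thesis using \<delta>X[OF xy] \<delta>3[OF xy] uniq i by blast
    next
      case False
      then show ?thesis using supp[OF i xy] by (auto simp: b_def split: if_splits)
    qed
    show "i = j" if "u \<in> W" "i \<in> A" "j \<in> A" "u \<in> X i - {v}" "u \<in> X j - {v}" for u i j
      using uniq that by auto
    show "d (x, y) = 0 \<and> d (y, x) = 0" if "x \<in> W" "y \<in> U" for x y
      using insert.prems(6) that by auto
  qed
  then obtain \<epsilon> where \<epsilon>: "\<forall>i\<in>A. (\<forall>e\<in>U \<times> U. 0 \<le> \<epsilon> i e) \<and> routes U (\<epsilon> i) (c' i) \<and>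
            (\<forall>x\<in>U. \<forall>y\<in>U. \<epsilon> i (x, y) \<noteq> 0 \<longrightarrow> x \<in> (X i - {v}) - W \<and> y \<in> (X i - {v}) - W)"
      and \<epsilon>d: "routes U d (\<lambda>e. \<Sum>i\<in>A. \<epsilon> i e)"
    by (elim exE conjE)
  show ?case
  proof (rule exI[of _ \<epsilon>], rule conjI[OF _ \<epsilon>d], rule ballI)
    fix i assume i: "i \<in> A"
    note \<epsilon>i = bspec[OF \<epsilon> i]
    have "routes U (\<epsilon> i) (c i)"
      by (rule routes_trans[OF U conjunct1[OF conjunct2[OF \<epsilon>i]] rc[OF i]])
    moreover have "x \<in> X i - insert v W \<and> y \<in> X i - insert v W"
      if xy: "x \<in> U" "y \<in> U" "\<epsilon> i (x, y) \<noteq> 0" for x y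
    proof -
      have "x \<in> (X i - {v}) - W \<and> y \<in> (X i - {v}) - W"
        by (rule mp[OF bspec[OF bspec[OF conjunct2[OF conjunct2[OF \<epsilon>i]] xy(1)] xy(2)] xy(3)])
      then show ?thesis by auto
    qed
    ultimately show "(\<forall>e\<in>U \<times> U. 0 \<le> \<epsilon> i e) \<and> routes U (\<epsilon> i) (c i) \<and>
        (\<forall>x\<in>U. \<forall>y\<in>U. \<epsilon> i (x, y) \<noteq> 0 \<longrightarrow> x \<in> X i - insert v W \<and> y \<in> X i - insert v W)"
      using conjunct1[OF \<epsilon>i] by simp
  qed
qed

section \<open>Networks and weights on ordered pairs\<close>

definition edge_capacity :: "'v network \<Rightarrow> 'v \<times> 'v \<Rightarrow> real" where
  "edge_capacity G e = (if {fst e, snd e} \<in> edges G then capacity G {fst e, snd e} else 0)"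

definition pair_demand :: "'v set \<Rightarrow> ('v set \<Rightarrow> real) \<Rightarrow> 'v \<times> 'v \<Rightarrow> real" where
  "pair_demand T d e = (if {fst e, snd e} \<in> [T]\<^bsup>2\<^esup> then d {fst e, snd e} else 0)"

lemma doubleton_in_nsets2: "{x, y} \<in> [T]\<^bsup>2\<^esup> \<longleftrightarrow> x \<in> T \<and> y \<in> T \<and> x \<noteq> y"
  by (auto simp: nsets_def card_2_iff)

text \<open>Net outflows sum to zero over all vertices, so the balance at \<open>t\<close>, which
  \<open>st_flow\<close> leaves out, is forced by the others.\<close>

lemma st_flow_iff:
  assumes V: "finite (verts G)" and st: "s \<in> verts G" "t \<in> verts G" "s \<noteq> t"
  shows "st_flow G s t x g \<longleftrightarrow> (\<forall>u v. 0 \<le> g u v) \<and> (\<forall>u v. {u, v} \<notin> edges G \<longrightarrow> g u v = 0) \<and>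
     (\<forall>y. (\<Sum>e\<in>verts G \<times> verts G. g (fst e) (snd e) * chi e y) = x * chi (s, t) y)"
    (is "_ \<longleftrightarrow> _ \<and> _ \<and> ?chi")
proof -
  define ex where "ex y = (\<Sum>u\<in>verts G. g y u) - (\<Sum>u\<in>verts G. g u y)" for y
  have ex: "(\<Sum>e\<in>verts G \<times> verts G. g (fst e) (snd e) * chi e y) = ex y" if "y \<in> verts G" for y
    using sum_chi[OF V that, of "\<lambda>e. g (fst e) (snd e)"] by (simp add: ex_def)
  have ex0: "(\<Sum>e\<in>verts G \<times> verts G. g (fst e) (snd e) * chi e y) = 0" if "y \<notin> verts G" for y
    using that chi_eq_0[of _ "verts G" y] by (intro sum.neutral) fastforce
  have total: "ex s + ex t + (\<Sum>y\<in>verts G - {s, t}. ex y) = 0"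
  proof -
    have "(\<Sum>y\<in>verts G. ex y) = 0"
      unfolding ex_def sum_subtractf by (subst sum.swap) simp
    moreover have "verts G - {s} - {t} = verts G - {s, t}" by auto
    ultimately show ?thesis
      using sum.remove[of "verts G" s ex] sum.remove[of "verts G - {s}" t ex] V st by simp
  qed
  have "(\<Sum>e\<in>verts G \<times> verts G. g (fst e) (snd e) * chi e y) = x * chi (s, t) y \<longleftrightarrow>
      (y \<in> verts G \<longrightarrow> ex y = x * chi (s, t) y)" for y
    using ex[of y] ex0[of y] st chi_eq_0[of "(s, t)" "verts G" y] by (cases "y \<in> verts G") auto
  then have "?chi \<longleftrightarrow> (\<forall>y\<in>verts G. ex y = x * chi (s, t) y)" by blast
  also have "\<dots> \<longleftrightarrow> (\<forall>y\<in>verts G - {s, t}. ex y = 0) \<and> ex s = x"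
  proof
    assume "\<forall>y\<in>verts G. ex y = x * chi (s, t) y"
    then show "(\<forall>y\<in>verts G - {s, t}. ex y = 0) \<and> ex s = x" using st by (auto simp: chi_def)
  next
    assume *: "(\<forall>y\<in>verts G - {s, t}. ex y = 0) \<and> ex s = x"
    then have "ex t = - x" using total by simp
    with * show "\<forall>y\<in>verts G. ex y = x * chi (s, t) y" using st by (auto simp: chi_def)
  qed
  finally have "?chi \<longleftrightarrow> (\<forall>y\<in>verts G - {s, t}. ex y = 0) \<and> ex s = x" .
  moreover have "(\<Sum>u\<in>verts G. g u y) = (\<Sum>u\<in>verts G. g y u) \<longleftrightarrow> ex y = 0" for y
    by (auto simp: ex_def)
  ultimately show ?thesis
    unfolding st_flow_def ex_def[symmetric] by blast
qed

lemma sum_ordered_pairs: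
  fixes h :: "'v \<times> 'v \<Rightarrow> real"
  assumes V: "finite V" "T \<subseteq> V" and \<sigma>: "\<And>p. p \<in> [T]\<^bsup>2\<^esup> \<Longrightarrow> p = {\<sigma> p, \<tau> p}"
  shows "(\<Sum>q\<in>V \<times> V. if {fst q, snd q} \<in> [T]\<^bsup>2\<^esup> then h q else 0) =
         (\<Sum>p\<in>[T]\<^bsup>2\<^esup>. h (\<sigma> p, \<tau> p) + h (\<tau> p, \<sigma> p))"
proof -
  have ne: "\<sigma> p \<noteq> \<tau> p" "\<sigma> p \<in> T" "\<tau> p \<in> T" if "p \<in> [T]\<^bsup>2\<^esup>" for p
    using \<sigma>[OF that] that doubleton_in_nsets2 by metis+
  have finT: "finite ([T]\<^bsup>2\<^esup>)" using V finite_imp_finite_nsets finite_subset by blast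
  define A where "A = (\<lambda>p. (\<sigma> p, \<tau> p)) ` [T]\<^bsup>2\<^esup>"
  define B where "B = (\<lambda>p. (\<tau> p, \<sigma> p)) ` [T]\<^bsup>2\<^esup>"
  have inj: "inj_on (\<lambda>p. (\<sigma> p, \<tau> p)) ([T]\<^bsup>2\<^esup>)" "inj_on (\<lambda>p. (\<tau> p, \<sigma> p)) ([T]\<^bsup>2\<^esup>)"
    using \<sigma> by (intro inj_onI; metis Pair_inject)+
  have disj: "A \<inter> B = {}"
  proof -
    have False if "p \<in> [T]\<^bsup>2\<^esup>" "p' \<in> [T]\<^bsup>2\<^esup>" "\<sigma> p = \<tau> p'" "\<tau> p = \<sigma> p'" for p p'
      using \<sigma>[OF that(1)] \<sigma>[OF that(2)] ne(1)[OF that(1)] that(3,4) by (metis insert_commute)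
    then show ?thesis unfolding A_def B_def by blast
  qed
  have AB: "{q \<in> V \<times> V. {fst q, snd q} \<in> [T]\<^bsup>2\<^esup>} = A \<union> B"
  proof (intro subset_antisym subsetI)
    fix q assume q: "q \<in> {q \<in> V \<times> V. {fst q, snd q} \<in> [T]\<^bsup>2\<^esup>}"
    define p where "p = {fst q, snd q}"
    have p: "p \<in> [T]\<^bsup>2\<^esup>" using q by (simp add: p_def)
    have "{fst q, snd q} = {\<sigma> p, \<tau> p}" using \<sigma>[OF p] p_def by simp
    then have "q = (\<sigma> p, \<tau> p) \<or> q = (\<tau> p, \<sigma> p)" by (auto simp: doubleton_eq_iff prod_eq_iff)
    then show "q \<in> A \<union> B" using p by (auto simp: A_def B_def)
  next
    fix q assume "q \<in> A \<union> B"
    then obtain p where "p \<in> [T]\<^bsup>2\<^esup>" "q = (\<sigma> p, \<tau> p) \<or> q = (\<tau> p, \<sigma> p)"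
      by (auto simp: A_def B_def)
    then show "q \<in> {q \<in> V \<times> V. {fst q, snd q} \<in> [T]\<^bsup>2\<^esup>}"
      using ne[of p] V(2) by (auto simp: doubleton_in_nsets2)
  qed
  have "(\<Sum>q\<in>V \<times> V. if {fst q, snd q} \<in> [T]\<^bsup>2\<^esup> then h q else 0) = (\<Sum>q\<in>A \<union> B. h q)"
    unfolding AB[symmetric] using V by (simp add: sum.inter_filter)
  also have "\<dots> = (\<Sum>q\<in>A. h q) + (\<Sum>q\<in>B. h q)"
    using finT disj by (intro sum.union_disjoint) (auto simp: A_def B_def)
  also have "(\<Sum>q\<in>A. h q) = (\<Sum>p\<in>[T]\<^bsup>2\<^esup>. h (\<sigma> p, \<tau> p))"
    unfolding A_def by (simp add: sum.reindex[OF inj(1)])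
  also have "(\<Sum>q\<in>B. h q) = (\<Sum>p\<in>[T]\<^bsup>2\<^esup>. h (\<tau> p, \<sigma> p))"
    unfolding B_def by (simp add: sum.reindex[OF inj(2)])
  finally show ?thesis by (simp add: sum.distrib)
qed

lemma networkD:
  assumes "network G"
  shows "finite (verts G)" "edges G \<subseteq> [verts G]\<^bsup>2\<^esup>" "\<And>e. 0 \<le> edge_capacity G e"
  using assms by (auto simp: network_def finite_graph_def edge_capacity_def)

text \<open>The two doublings, of commodities and of arcs, balance out. Forwards, a flow and its
  reversal load either arc with \<open>f p u v + f p v u\<close>. Backwards, one ordered commodity
  is averaged with the reversal of the other, which loads the edge with at most half the sum of the
  two arc loads.\<close>

lemma routable_iff_routes:
  assumes G: "network G" and T: "T \<subseteq> verts G"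
  shows "routable G T d \<longleftrightarrow> routes (verts G) (pair_demand T d) (edge_capacity G)"
proof
  define V where "V = verts G"
  note V = networkD(1)[OF G, folded V_def] and TV = T[folded V_def]
  assume "routable G T d"
  then obtain f where f: "\<forall>p\<in>[T]\<^bsup>2\<^esup>. \<exists>s t. p = {s, t} \<and> st_flow G s t (d p) (f p)"
    and cap: "\<And>u v. {u, v} \<in> edges G \<Longrightarrow> (\<Sum>p\<in>[T]\<^bsup>2\<^esup>. f p u v + f p v u) \<le> capacity G {u, v}"
    unfolding routable_def by blast
  obtain \<sigma> \<tau> where \<sigma>: "\<And>p. p \<in> [T]\<^bsup>2\<^esup> \<Longrightarrow> p = {\<sigma> p, \<tau> p}"
    and fl: "\<And>p. p \<in> [T]\<^bsup>2\<^esup> \<Longrightarrow> st_flow G (\<sigma> p) (\<tau> p) (d p) (f p)"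
    using f by metis
  have ne: "\<sigma> p \<noteq> \<tau> p" "\<sigma> p \<in> V" "\<tau> p \<in> V" if "p \<in> [T]\<^bsup>2\<^esup>" for p
    using \<sigma>[OF that] that doubleton_in_nsets2 TV by (metis, (metis subsetD)+)
  have fl': "0 \<le> f p u v" "{u, v} \<notin> edges G \<Longrightarrow> f p u v = 0"
      "(\<Sum>e\<in>V \<times> V. f p (fst e) (snd e) * chi e y) = d p * chi (\<sigma> p, \<tau> p) y"
    if "p \<in> [T]\<^bsup>2\<^esup>" for p u v y
    using fl[OF that] st_flow_iff[of G "\<sigma> p" "\<tau> p" "d p" "f p"] ne[OF that] V
    unfolding V_def by blast+
  have fl_rev: "(\<Sum>e\<in>V \<times> V. f p (snd e) (fst e) * chi e y) = d p * chi (\<tau> p, \<sigma> p) y"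
    if p: "p \<in> [T]\<^bsup>2\<^esup>" for p y
  proof -
    have "(\<Sum>e\<in>V \<times> V. f p (snd e) (fst e) * chi e y)
        = - (\<Sum>e\<in>V \<times> V. f p (fst (prod.swap e)) (snd (prod.swap e)) * chi (prod.swap e) y)"
      by (simp add: chi_swap sum_negf)
    also have "\<dots> = - (d p * chi (\<sigma> p, \<tau> p) y)"
      unfolding sum_swap_Times[of "\<lambda>e. f p (fst e) (snd e) * chi e y"] fl'(3)[OF p] ..
    finally show ?thesis by (simp add: chi_def)
  qed
  define k where "k q e = (let p = {fst q, snd q} in if p \<in> [T]\<^bsup>2\<^esup> then
      (if q = (\<sigma> p, \<tau> p) then f p (fst e) (snd e) else f p (snd e) (fst e)) else 0)" for q e
  have kf: "k (\<sigma> p, \<tau> p) e = f p (fst e) (snd e)" "k (\<tau> p, \<sigma> p) e = f p (snd e) (fst e)"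
    if p: "p \<in> [T]\<^bsup>2\<^esup>" for p e
  proof -
    have "{\<sigma> p, \<tau> p} = p" "{\<tau> p, \<sigma> p} = p" using \<sigma>[OF p] by auto
    then show "k (\<sigma> p, \<tau> p) e = f p (fst e) (snd e)" "k (\<tau> p, \<sigma> p) e = f p (snd e) (fst e)"
      using p ne(1)[OF p] by (auto simp: k_def Let_def)
  qed
  have "routing V (pair_demand T d) (edge_capacity G) k"
  proof (rule routingI)
    show "0 \<le> k q e" for q e using fl'(1) by (auto simp: k_def Let_def)
    show "(\<Sum>e\<in>V \<times> V. k q e * chi e x) = pair_demand T d q * chi q x" for q x
    proof (cases "{fst q, snd q} \<in> [T]\<^bsup>2\<^esup>")
      case True
      define p where "p = {fst q, snd q}"
      have p: "p \<in> [T]\<^bsup>2\<^esup>" using True by (simp add: p_def)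
      have "{fst q, snd q} = {\<sigma> p, \<tau> p}" using \<sigma>[OF p] p_def by simp
      then have "q = (\<sigma> p, \<tau> p) \<or> q = (\<tau> p, \<sigma> p)" by (auto simp: doubleton_eq_iff prod_eq_iff)
      moreover have "pair_demand T d q = d p" using True by (simp add: pair_demand_def p_def)
      ultimately show ?thesis
        by (elim disjE) (simp_all only: kf[OF p] fl'(3)[OF p] fl_rev[OF p])
    next
      case False
      then have "k q e = 0" for e by (simp only: k_def Let_def if_False)
      moreover have "pair_demand T d q = 0" using False by (simp only: pair_demand_def if_False)
      ultimately show ?thesis by simp
    qed
    show "(\<Sum>q\<in>V \<times> V. k q e) \<le> edge_capacity G e" for e
    proof -
      have "(\<Sum>q\<in>V \<times> V. k q e) = (\<Sum>q\<in>V \<times> V. if {fst q, snd q} \<in> [T]\<^bsup>2\<^esup> then k q e else 0)"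
        by (intro sum.cong) (auto simp: k_def)
      also have "\<dots> = (\<Sum>p\<in>[T]\<^bsup>2\<^esup>. k (\<sigma> p, \<tau> p) e + k (\<tau> p, \<sigma> p) e)"
        by (rule sum_ordered_pairs[OF V TV \<sigma>])
      also have "\<dots> = (\<Sum>p\<in>[T]\<^bsup>2\<^esup>. f p (fst e) (snd e) + f p (snd e) (fst e))"
        using kf by (intro sum.cong) auto
      also have "\<dots> \<le> edge_capacity G e"
        using cap[of "fst e" "snd e"] fl'(2)
        by (auto simp: edge_capacity_def insert_commute)
      finally show ?thesis .
    qed
  qed
  then show "routes (verts G) (pair_demand T d) (edge_capacity G)"
    unfolding routes_def V_def by blast
next
  define V where "V = verts G"
  note V = networkD(1)[OF G, folded V_def] and TV = T[folded V_def]
  note E = networkD(2)[OF G, folded V_def]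
  assume "routes (verts G) (pair_demand T d) (edge_capacity G)"
  then obtain k where k: "routing V (pair_demand T d) (edge_capacity G) k"
    unfolding routes_def V_def by blast
  have "\<exists>s t. p = {s, t}" if "p \<in> [T]\<^bsup>2\<^esup>" for p
    using that by (auto simp: nsets_def card_2_iff)
  then obtain \<sigma> \<tau> where \<sigma>: "\<And>p. p \<in> [T]\<^bsup>2\<^esup> \<Longrightarrow> p = {\<sigma> p, \<tau> p}" by metis
  have ne: "\<sigma> p \<noteq> \<tau> p" "\<sigma> p \<in> V" "\<tau> p \<in> V" if "p \<in> [T]\<^bsup>2\<^esup>" for p
    using \<sigma>[OF that] that doubleton_in_nsets2 TV by (metis, (metis subsetD)+)
  define f where "f p u v = (if {u, v} \<in> edges G
      then (k (\<sigma> p, \<tau> p) (u, v) + k (\<tau> p, \<sigma> p) (v, u)) / 2 else 0)" for p u v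
  have k0: "0 \<le> k q e" if "q \<in> V \<times> V" "e \<in> V \<times> V" for q e using routingD(1)[OF k that] .
  have koff: "k q (u, v) = 0" if "q \<in> V \<times> V" "u \<in> V" "v \<in> V" "{u, v} \<notin> edges G" for q u v
    using k0[of q "(u, v)"] routing_le_capacity[OF k V, of q "(u, v)"] that
    by (auto simp: edge_capacity_def)
  have EV: "u \<in> V" "v \<in> V" if "{u, v} \<in> edges G" for u v
    using E that by (auto simp: doubleton_in_nsets2 subset_iff)
  have "st_flow G (\<sigma> p) (\<tau> p) (d p) (f p)" if p: "p \<in> [T]\<^bsup>2\<^esup>" for p
  proof -
    have q: "(\<sigma> p, \<tau> p) \<in> V \<times> V" "(\<tau> p, \<sigma> p) \<in> V \<times> V" using ne[OF p] by auto
    have "{\<sigma> p, \<tau> p} = p" "{\<tau> p, \<sigma> p} = p" using \<sigma>[OF p] by auto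
    then have pd: "pair_demand T d (\<sigma> p, \<tau> p) = d p" "pair_demand T d (\<tau> p, \<sigma> p) = d p"
      using p by (auto simp: pair_demand_def)
    have "(\<Sum>e\<in>V \<times> V. f p (fst e) (snd e) * chi e y) = d p * chi (\<sigma> p, \<tau> p) y" for y
    proof -
      have "(\<Sum>e\<in>V \<times> V. f p (fst e) (snd e) * chi e y) =
          (\<Sum>e\<in>V \<times> V. k (\<sigma> p, \<tau> p) e * chi e y / 2 -
             k (\<tau> p, \<sigma> p) (prod.swap e) * chi (prod.swap e) y / 2)"
      proof (intro sum.cong refl)
        fix e assume e: "e \<in> V \<times> V"
        obtain a b where ab: "e = (a, b)" "a \<in> V" "b \<in> V" using e by auto
        have "f p a b = k (\<sigma> p, \<tau> p) (a, b) / 2 + k (\<tau> p, \<sigma> p) (b, a) / 2"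
          using koff[OF q(1) ab(2,3)] koff[OF q(2) ab(3,2)]
          by (cases "{a, b} \<in> edges G") (simp_all add: f_def insert_commute add_divide_distrib)
        then show "f p (fst e) (snd e) * chi e y = k (\<sigma> p, \<tau> p) e * chi e y / 2 -
             k (\<tau> p, \<sigma> p) (prod.swap e) * chi (prod.swap e) y / 2"
          unfolding chi_swap using ab(1) by (simp add: algebra_simps)
      qed
      also have "\<dots> = d p * chi (\<sigma> p, \<tau> p) y / 2 - d p * chi (\<tau> p, \<sigma> p) y / 2"
        unfolding sum_subtractf sum_divide_distrib[symmetric]
          sum_swap_Times[of "\<lambda>e. k (\<tau> p, \<sigma> p) e * chi e y"]
          routingD(2)[OF k q(1)] routingD(2)[OF k q(2)] pd by simp
      finally show ?thesis by (simp add: chi_def)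
    qed
    moreover have "0 \<le> f p u v" for u v using k0 q EV[of u v] by (auto simp: f_def)
    ultimately show ?thesis
      using st_flow_iff[of G "\<sigma> p" "\<tau> p" "d p" "f p"] ne[OF p] V
      unfolding V_def by (simp add: f_def)
  qed
  moreover have "(\<Sum>p\<in>[T]\<^bsup>2\<^esup>. f p u v + f p v u) \<le> capacity G {u, v}" if uv: "{u, v} \<in> edges G" for u v
  proof -
    have vu: "{v, u} \<in> edges G" using uv by (simp add: insert_commute)
    define h where "h q = (k q (u, v) + k q (v, u)) / 2" for q
    have e: "(u, v) \<in> V \<times> V" "(v, u) \<in> V \<times> V" using EV[OF uv] by auto
    have "(\<Sum>p\<in>[T]\<^bsup>2\<^esup>. f p u v + f p v u) = (\<Sum>p\<in>[T]\<^bsup>2\<^esup>. h (\<sigma> p, \<tau> p) + h (\<tau> p, \<sigma> p))"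
      using uv vu by (intro sum.cong) (auto simp: f_def h_def field_simps)
    also have "\<dots> = (\<Sum>q\<in>V \<times> V. if {fst q, snd q} \<in> [T]\<^bsup>2\<^esup> then h q else 0)"
      by (rule sum_ordered_pairs[OF V TV \<sigma>, symmetric])
    \<comment> \<open>Commodities other than terminal pairs may carry circulations in
      \<open>k\<close>; dropping them only lowers the load.\<close>
    also have "\<dots> \<le> (\<Sum>q\<in>V \<times> V. h q)"
      using k0 e by (intro sum_mono) (auto simp: h_def)
    also have "\<dots> = ((\<Sum>q\<in>V \<times> V. k q (u, v)) + (\<Sum>q\<in>V \<times> V. k q (v, u))) / 2"
      by (simp add: h_def sum.distrib flip: sum_divide_distrib)
    also have "\<dots> \<le> (edge_capacity G (u, v) + edge_capacity G (v, u)) / 2"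
      using routingD(3)[OF k e(1)] routingD(3)[OF k e(2)] by simp
    also have "\<dots> = capacity G {u, v}" using uv vu by (simp add: edge_capacity_def insert_commute)
    finally show ?thesis .
  qed
  ultimately show "routable G T d"
    unfolding routable_def using \<sigma> by (intro exI[of _ f]) blast
qed

section \<open>From throughput to routability of scaled demands\<close>

lemma pair_demand_scale: "pair_demand T (\<lambda>p. r * d p) = (\<lambda>p. r * pair_demand T d p)"
  by (auto simp: pair_demand_def)

lemma demand_scale: "demand T d \<Longrightarrow> 0 \<le> r \<Longrightarrow> demand T (\<lambda>p. r * d p)"
  by (auto simp: demand_def)

lemma pair_demand_nonneg: "demand T d \<Longrightarrow> 0 \<le> pair_demand T d p"
  by (auto simp: demand_def pair_demand_def)

lemma routable_scale_le:
  assumes G: "network G" "T \<subseteq> verts G" and "routable G T d" "0 \<le> r" "r \<le> 1"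
  shows "routable G T (\<lambda>p. r * d p)"
  using assms routes_scale_le[of "verts G" _ _ r] networkD(3)[OF G(1)]
  by (simp add: routable_iff_routes pair_demand_scale)

text \<open>Routable multiples are closed downwards, so everything strictly below the supremum is
  routable.\<close>

lemma routable_less_throughput:
  assumes G: "network G" "T \<subseteq> verts G" and d: "nonzero_demand T d" and r: "0 \<le> r" "r < throughput G T d"
  shows "routable G T (\<lambda>p. r * d p)"
proof -
  obtain l where l: "0 \<le> l" "routable G T (\<lambda>p. l * d p)" "r < l"
    using r less_cSupD[of "{l. 0 \<le> l \<and> routable G T (\<lambda>p. l * d p)}" r]
      throughput_set_nonempty[OF G(1)] unfolding throughput_def by blast
  have "routable G T (\<lambda>p. (r / l) * (l * d p))"
    using l r by (intro routable_scale_le[OF G l(2)]) auto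
  then show ?thesis using l r by simp
qed

lemma le_throughput:
  assumes "network G" "T \<subseteq> verts G" "nonzero_demand T d" "0 \<le> l" "routable G T (\<lambda>p. l * d p)"
  shows "l \<le> throughput G T d"
  unfolding throughput_def
  using assms by (intro cSup_upper throughput_set_bdd_above) auto

lemma throughput_le:
  assumes "network G" "\<And>l. 0 \<le> l \<Longrightarrow> routable G T (\<lambda>p. l * d p) \<Longrightarrow> l \<le> b"
  shows "throughput G T d \<le> b"
  unfolding throughput_def
  using assms throughput_set_nonempty[of G T d] by (intro cSup_least) blast+

text \<open>
  The factor \<open>r < 1\<close> makes it unnecessary to know that the supremum in \<^const>\<open>throughput\<close>
  is attained.
\<close>

lemma flow_sparsifier_iff:
  assumes G: "network G" "T \<subseteq> verts G"
  shows "flow_sparsifier q G T G' \<longleftrightarrow> 1 \<le> q \<and> network G' \<and> T \<subseteq> verts G' \<and>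
    (\<forall>d r. demand T d \<longrightarrow> 0 \<le> r \<longrightarrow> r < 1 \<longrightarrow>
       (routable G T d \<longrightarrow> routable G' T (\<lambda>p. r * d p)) \<and>
       (routable G' T d \<longrightarrow> routable G T (\<lambda>p. r / q * d p)))"
    (is "_ \<longleftrightarrow> _ \<and> _ \<and> _ \<and> ?R")
proof (intro iffI)
  assume sp: "flow_sparsifier q G T G'"
  then have q: "1 \<le> q" and G': "network G'" "T \<subseteq> verts G'"
    and th: "\<And>d. nonzero_demand T d \<Longrightarrow>
      throughput G T d \<le> throughput G' T d \<and> throughput G' T d \<le> q * throughput G T d"
    by (auto simp: flow_sparsifier_def)
  have "(routable G T d \<longrightarrow> routable G' T (\<lambda>p. r * d p)) \<and>
       (routable G' T d \<longrightarrow> routable G T (\<lambda>p. r / q * d p))"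
    if d: "demand T d" and r: "0 \<le> r" "r < 1" for d r
  proof (cases "nonzero_demand T d")
    case True
    note tp = th[OF True]
    have "routable G' T (\<lambda>p. r * d p)" if "routable G T d"
    proof -
      have "1 \<le> throughput G T d" using that by (intro le_throughput G True) auto
      then show ?thesis using tp r by (intro routable_less_throughput G' True) auto
    qed
    moreover have "routable G T (\<lambda>p. r / q * d p)" if "routable G' T d"
    proof -
      have "1 \<le> throughput G' T d" using that by (intro le_throughput G' True) auto
      then have "1 \<le> q * throughput G T d" using tp by linarith
      then have "r < throughput G T d * q" using r by (simp add: mult.commute)
      then have "r / q < throughput G T d" using q by (simp add: pos_divide_less_eq)
      then show ?thesis using r q by (intro routable_less_throughput G True) auto
    qed
    ultimately show ?thesis by blast
  next
    \<comment> \<open>Quality speaks of nonzero demands only; a zero demand is routed by the zero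
      flow.\<close>
    case False
    then have z: "pair_demand T d p = 0" for p
      using d by (auto simp: nonzero_demand_def pair_demand_def)
    show ?thesis
      unfolding routable_iff_routes[OF G] routable_iff_routes[OF G'] pair_demand_scale
      using networkD(3)[OF G(1)] networkD(3)[OF G'(1)] by (auto simp: z intro: routes_zero)
  qed
  then show "1 \<le> q \<and> network G' \<and> T \<subseteq> verts G' \<and> ?R" using q G' by blast
next
  assume *: "1 \<le> q \<and> network G' \<and> T \<subseteq> verts G' \<and> ?R"
  then have q: "1 \<le> q" and G': "network G'" "T \<subseteq> verts G'" and R: ?R by blast+
  have "throughput G T d \<le> throughput G' T d \<and> throughput G' T d \<le> q * throughput G T d"
    if nz: "nonzero_demand T d" for d
  proof
    have d: "demand T (\<lambda>p. l * d p)" if "0 \<le> l" for l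
      using nz that by (intro demand_scale) (auto simp: nonzero_demand_def)
    show "throughput G T d \<le> throughput G' T d"
    proof (rule throughput_le[OF G(1)])
      fix l :: real assume l: "0 \<le> l" "routable G T (\<lambda>p. l * d p)"
      \<comment> \<open>Letting \<open>r\<close> tend to 1 recovers the bound for \<open>l\<close>
        itself.\<close>
      have "r * l \<le> throughput G' T d" if "0 < r" "r < 1" for r
      proof (rule le_throughput[OF G' nz])
        show "routable G' T (\<lambda>p. r * l * d p)"
          using R[rule_format, OF d[OF l(1)], of r] that l(2) by (simp add: mult.assoc)
      qed (use that l in auto)
      then show "l \<le> throughput G' T d" by (rule field_le_mult_one_interval)
    qed
    show "throughput G' T d \<le> q * throughput G T d"
    proof (rule throughput_le[OF G'(1)])
      fix l :: real assume l: "0 \<le> l" "routable G' T (\<lambda>p. l * d p)"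
      have "r * l \<le> q * throughput G T d" if "0 < r" "r < 1" for r
      proof -
        have "r / q * l \<le> throughput G T d"
        proof (rule le_throughput[OF G nz])
          show "routable G T (\<lambda>p. r / q * l * d p)"
            using R[rule_format, OF d[OF l(1)], of r] that l(2) by (simp add: mult.assoc)
        qed (use that l q in auto)
        then show ?thesis using q by (simp add: field_simps)
      qed
      then show "l \<le> q * throughput G T d" by (rule field_le_mult_one_interval)
    qed
  qed
  then show "flow_sparsifier q G T G'" unfolding flow_sparsifier_def using q G' by blast
qed

text \<open>The weights that stem from undirected edges or demands. One predicate covers both,
  because boundary weights act as demands on a piece and as capacities for the whole. Vanishing
  outside \<open>X\<close> lets them be moved to larger vertex sets.\<close>

definition symmetric_on :: "'v set \<Rightarrow> ('v \<times> 'v \<Rightarrow> real) \<Rightarrow> bool" where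
  "symmetric_on X c \<longleftrightarrow> (\<forall>e. 0 \<le> c e) \<and> (\<forall>x y. c (x, y) = c (y, x)) \<and>
     (\<forall>x y. c (x, y) \<noteq> 0 \<longrightarrow> x \<noteq> y \<and> x \<in> X \<and> y \<in> X)"

lemma symmetric_onD:
  assumes "symmetric_on X c"
  shows "0 \<le> c e" "c (x, y) = c (y, x)" "c (x, x) = 0" "c (x, y) \<noteq> 0 \<Longrightarrow> x \<in> X" "c (x, y) \<noteq> 0 \<Longrightarrow> y \<in> X"
  using assms unfolding symmetric_on_def by blast+

lemma symmetric_on_eq_0:
  assumes "symmetric_on X c" "\<not> (x \<in> X \<and> y \<in> X \<and> x \<noteq> y)"
  shows "c (x, y) = 0"
  using assms unfolding symmetric_on_def by blast

lemma symmetric_on_mono: "symmetric_on X c \<Longrightarrow> X \<subseteq> Y \<Longrightarrow> symmetric_on Y c"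
  unfolding symmetric_on_def by blast

text \<open>The way back from ordered to unordered pairs; for symmetric weights it does not matter
  which ordering is chosen.\<close>

definition of_pair :: "('v \<times> 'v \<Rightarrow> real) \<Rightarrow> 'v set \<Rightarrow> real" where
  "of_pair c p = c (SOME e. p = {fst e, snd e})"

lemma of_pair:
  assumes "symmetric_on X c"
  shows "of_pair c {x, y} = c (x, y)"
proof -
  define e where "e = (SOME e. {x, y} = {fst e, snd e})"
  have "{x, y} = {fst e, snd e}"
    unfolding e_def by (rule someI_ex) (rule exI[of _ "(x, y)"], simp)
  then have "e = (x, y) \<or> e = (y, x)" by (auto simp: doubleton_eq_iff prod_eq_iff)
  then show ?thesis using symmetric_onD(2)[OF assms] by (auto simp: of_pair_def e_def)
qed

lemma symmetric_on_edge_capacity: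
  assumes "network G"
  shows "symmetric_on (verts G) (edge_capacity G)"
proof -
  have "x \<noteq> y \<and> x \<in> verts G \<and> y \<in> verts G" if "edge_capacity G (x, y) \<noteq> 0" for x y
  proof -
    have "{x, y} \<in> edges G" using that by (simp add: edge_capacity_def split: if_splits)
    then have "{x, y} \<in> [verts G]\<^bsup>2\<^esup>" using networkD(2)[OF assms] by blast
    then show ?thesis by (simp add: doubleton_in_nsets2)
  qed
  then show ?thesis
    using networkD(3)[OF assms]
    by (simp add: symmetric_on_def) (simp add: edge_capacity_def insert_commute)
qed

lemma symmetric_on_pair_demand:
  assumes "demand T d"
  shows "symmetric_on T (pair_demand T d)"
  using pair_demand_nonneg[OF assms]
  by (auto simp: symmetric_on_def pair_demand_def insert_commute doubleton_in_nsets2 split: if_splits)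

lemma pair_demand_of_pair:
  assumes "symmetric_on T d"
  shows "pair_demand T (of_pair d) = d" "demand T (of_pair d)"
proof -
  show "pair_demand T (of_pair d) = d"
    using symmetric_on_eq_0[OF assms] of_pair[OF assms]
    by (simp add: pair_demand_def doubleton_in_nsets2 fun_eq_iff)
  have "0 \<le> of_pair d p" for p using symmetric_onD(1)[OF assms] by (simp add: of_pair_def)
  then show "demand T (of_pair d)" by (simp add: demand_def)
qed

text \<open>
  Edges of capacity zero do not affect routability, so every capacity function is realised by a
  complete, hence connected, graph.
\<close>

definition complete_network :: "'v set \<Rightarrow> ('v \<times> 'v \<Rightarrow> real) \<Rightarrow> 'v network" where
  "complete_network X c = \<lparr>verts = X, edges = [X]\<^bsup>2\<^esup>, capacity = of_pair c\<rparr>"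

lemma complete_network:
  assumes "finite X" "X \<noteq> {}" and c: "symmetric_on X c"
  shows "network (complete_network X c)" "verts (complete_network X c) = X"
    "edge_capacity (complete_network X c) = c"
proof -
  have "(u, v) \<in> {(x, y). {x, y} \<in> [X]\<^bsup>2\<^esup>}\<^sup>*" if "u \<in> X" "v \<in> X" for u v
    using that by (cases "u = v") (auto simp: doubleton_in_nsets2)
  then show "network (complete_network X c)"
    using assms symmetric_onD(1)[OF c]
    by (auto simp: network_def complete_network_def finite_graph_def connected_graph_def of_pair_def)
  show "verts (complete_network X c) = X" by (simp add: complete_network_def)
  show "edge_capacity (complete_network X c) = c"
    using symmetric_on_eq_0[OF c] of_pair[OF c]
    by (simp add: edge_capacity_def complete_network_def doubleton_in_nsets2 fun_eq_iff)
qed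

text \<open>A demand of a vertex to itself is void.\<close>

lemma routes_offdiag:
  assumes "routes U d c" "\<And>x y. x \<noteq> y \<Longrightarrow> d' (x, y) = d (x, y)"
  shows "routes U d' c"
proof -
  obtain f where f: "routing U d c f" using assms(1) unfolding routes_def by blast
  have eq: "d p * chi p x = d' p * chi p x" for p x
    using assms(2) by (cases p; cases "fst p = snd p") (auto simp: chi_def)
  have "routing U d' c f"
    by (intro routingI routingD(1,3)[OF f] trans[OF routingD(2)[OF f] eq])
  then show ?thesis unfolding routes_def by blast
qed

text \<open>Eliminating everything outside \<open>Z\<close> leaves piece \<open>i\<close> with
  weights on \<open>R i\<close>, which \<open>step\<close> transfers to \<open>c' i\<close>. The
  factor \<open>s\<close> is common to all pieces and therefore survives summation. Only
  \<open>step\<close> relates \<open>c\<close> to \<open>c'\<close>, so the lemma serves both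
  directions, from pieces to sparsifiers and back.\<close>

lemma routes_sparsify_pieces:
  assumes U: "finite U" and A: "finite A"
    and r: "routes U d (\<lambda>e. \<Sum>i\<in>A. c i e)" and d: "symmetric_on T d"
    and c: "\<And>i. i \<in> A \<Longrightarrow> symmetric_on (X i) (c i)"
    and X: "\<And>i. i \<in> A \<Longrightarrow> X i \<subseteq> U"
    and R: "\<And>i. i \<in> A \<Longrightarrow> X i \<inter> Z \<subseteq> R i" and T: "T \<subseteq> Z"
    and disj: "\<And>i j. i \<in> A \<Longrightarrow> j \<in> A \<Longrightarrow> i \<noteq> j \<Longrightarrow> X i \<inter> X j \<subseteq> Z"
    and s: "0 \<le> s" and step: "\<And>i \<delta>. i \<in> A \<Longrightarrow> symmetric_on (R i) \<delta> \<Longrightarrow>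
      routes U \<delta> (c i) \<Longrightarrow> routes U (\<lambda>p. s * \<delta> p) (c' i)"
  shows "routes U (\<lambda>p. s * d p) (\<lambda>e. \<Sum>i\<in>A. c' i e)"
proof -
  have "\<exists>\<delta>. (\<forall>i\<in>A. (\<forall>e\<in>U \<times> U. 0 \<le> \<delta> i e) \<and> routes U (\<delta> i) (c i) \<and>
            (\<forall>x\<in>U. \<forall>y\<in>U. \<delta> i (x, y) \<noteq> 0 \<longrightarrow> x \<in> X i - (U - Z) \<and> y \<in> X i - (U - Z))) \<and>
          routes U d (\<lambda>e. \<Sum>i\<in>A. \<delta> i e)"
  proof (rule routes_split[OF U A _ _ r])
    show "0 \<le> c i e" if "i \<in> A" for i e using symmetric_onD(1)[OF c[OF that]] .
    show "x \<in> X i \<and> y \<in> X i" if "i \<in> A" "c i (x, y) \<noteq> 0" for i x y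
      using symmetric_onD(4,5)[OF c[OF that(1)] that(2)] by blast
    show "i = j" if "v \<in> U - Z" "i \<in> A" "j \<in> A" "v \<in> X i" "v \<in> X j" for v i j
      using disj[of i j] that by blast
    show "d (x, y) = 0 \<and> d (y, x) = 0" if "x \<in> U - Z" for x y
      using symmetric_onD(4,5)[OF d] that T by blast
  qed (use U in auto)
  then obtain \<delta> where \<delta>: "\<forall>i\<in>A. (\<forall>e\<in>U \<times> U. 0 \<le> \<delta> i e) \<and> routes U (\<delta> i) (c i) \<and>
            (\<forall>x\<in>U. \<forall>y\<in>U. \<delta> i (x, y) \<noteq> 0 \<longrightarrow> x \<in> X i - (U - Z) \<and> y \<in> X i - (U - Z))"
     and d\<delta>: "routes U d (\<lambda>e. \<Sum>i\<in>A. \<delta> i e)"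
    by (elim exE conjE)
  \<comment> \<open>The weights \<open>\<delta> i\<close> need not be symmetric. As \<open>d\<close>
    and \<open>c i\<close> are, averaging with the reversal keeps both routing statements.\<close>
  define \<epsilon> where "\<epsilon> i e = (\<delta> i e + \<delta> i (prod.swap e)) / 2" for i e
  have d_swap: "d \<circ> prod.swap = d" using symmetric_onD(2)[OF d] by (auto simp: fun_eq_iff)
  have "routes U (d \<circ> prod.swap) ((\<lambda>e. \<Sum>i\<in>A. \<delta> i e) \<circ> prod.swap)" using routes_swap[OF d\<delta>] .
  from routes_scale[OF routes_add[OF d\<delta> this[unfolded d_swap]], of "1/2"]
  have d\<epsilon>: "routes U d (\<lambda>e. \<Sum>i\<in>A. \<epsilon> i e)"
    by (simp add: \<epsilon>_def sum.distrib flip: sum_divide_distrib)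
  have \<epsilon>c: "routes U (\<lambda>p. s * \<epsilon> i p) (c' i)" if i: "i \<in> A" for i
  proof -
    note \<delta>i = bspec[OF \<delta> i]
    have \<delta>R: "x \<in> R i \<and> y \<in> R i" if "x \<in> U" "y \<in> U" "\<delta> i (x, y) \<noteq> 0" for x y
      using mp[OF bspec[OF bspec[OF conjunct2[OF conjunct2[OF \<delta>i]] that(1)] that(2)] that(3)]
        R[OF i] that by blast
    have \<delta>0: "0 \<le> \<delta> i (x, y)" if "x \<in> U" "y \<in> U" for x y using conjunct1[OF \<delta>i] that by blast
    \<comment> \<open>Elimination may create weights on loops, when flow enters and leaves a vertex
      through the same neighbour, and it says nothing about pairs outside \<open>U\<close>. Both are
      cut off to obtain \<open>symmetric_on\<close>; since a loop demand is void, routability in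
      \<open>U\<close> is unaffected.\<close>
    define \<epsilon>' where "\<epsilon>' p = (if fst p \<noteq> snd p \<and> p \<in> U \<times> U then \<epsilon> i p else 0)" for p
    have c_swap: "c i \<circ> prod.swap = c i" using symmetric_onD(2)[OF c[OF i]] by (auto simp: fun_eq_iff)
    note \<delta>c = conjunct1[OF conjunct2[OF \<delta>i]]
    have "routes U (\<delta> i \<circ> prod.swap) (c i)" using routes_swap[OF \<delta>c] unfolding c_swap .
    from routes_scale[OF routes_add[OF \<delta>c this], of "1/2"]
    have "routes U (\<epsilon> i) (c i)" by (simp add: \<epsilon>_def[abs_def])
    then have "routes U (\<lambda>p. if p \<in> U \<times> U then \<epsilon> i p else 0) (c i)"
      by (rule iffD1[OF routes_cong, rotated 2]) auto
    then have "routes U \<epsilon>' (c i)"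
      by (rule routes_offdiag) (auto simp: \<epsilon>'_def)
    moreover have "symmetric_on (R i) \<epsilon>'"
      unfolding symmetric_on_def
    proof (intro conjI allI impI)
      show "0 \<le> \<epsilon>' e" for e using \<delta>0 by (cases e) (auto simp: \<epsilon>'_def \<epsilon>_def)
      show "\<epsilon>' (x, y) = \<epsilon>' (y, x)" for x y by (auto simp: \<epsilon>'_def \<epsilon>_def)
      fix x y assume n: "\<epsilon>' (x, y) \<noteq> 0"
      then have xy: "x \<in> U" "y \<in> U" "x \<noteq> y" "\<delta> i (x, y) \<noteq> 0 \<or> \<delta> i (y, x) \<noteq> 0"
        by (auto simp: \<epsilon>'_def \<epsilon>_def split: if_splits)
      show "x \<noteq> y" "x \<in> R i" "y \<in> R i" using xy \<delta>R by blast+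
    qed
    ultimately have "routes U (\<lambda>p. s * \<epsilon>' p) (c' i)" using step[OF i] by blast
    then have "routes U (\<lambda>p. if p \<in> U \<times> U then s * \<epsilon> i p else 0) (c' i)"
      by (rule routes_offdiag) (auto simp: \<epsilon>'_def)
    then show ?thesis by (rule iffD1[OF routes_cong, rotated 2]) auto
  qed
  have "routes U (\<lambda>p. s * d p) (\<lambda>e. s * (\<Sum>i\<in>A. \<epsilon> i e))" by (rule routes_scale[OF d\<epsilon> s])
  then have "routes U (\<lambda>p. s * d p) (\<lambda>e. \<Sum>i\<in>A. s * \<epsilon> i e)" by (simp only: sum_distrib_left)
  then show ?thesis by (rule routes_trans[OF U _ routes_sum[OF A \<epsilon>c]])
qed

section \<open>Gluing sparsifiers of pieces\<close>

lemma fresh_finite_set: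
  fixes Z :: "'v::infinite set"
  assumes "finite Z"
  obtains B where "finite B" "card B = n" "B \<inter> Z = {}"
  using infinite_arbitrarily_large[of "- Z" n] assms infinite_UNIV
  by (metis Compl_eq_Diff_UNIV Diff_infinite_finite disjoint_eq_subset_Compl)

text \<open>A sparsifier supplied by hypothesis may reuse arbitrary vertices. After renaming it
  meets the rest of the construction in its boundary only; the infinite vertex type provides the
  names.\<close>

lemma fresh_renaming:
  fixes Z :: "'v::infinite set"
  assumes X: "finite X" and R: "R \<subseteq> X" and Z: "finite Z"
  obtains \<rho> where "inj_on \<rho> X" "\<And>x. x \<in> R \<Longrightarrow> \<rho> x = x" "\<rho> ` X \<inter> Z \<subseteq> R"
proof -
  obtain B :: "'v set" where B: "finite B" "card B = card (X - R)" "B \<inter> (Z \<union> R) = {}"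
    using fresh_finite_set[of "Z \<union> R" "card (X - R)"] Z R X finite_subset by blast
  obtain h where h: "bij_betw h (X - R) B"
    using finite_same_card_bij[of "X - R" B] B X by auto
  define \<rho> where "\<rho> x = (if x \<in> R then x else h x)" for x
  have hB: "h x \<in> B" if "x \<in> X" "x \<notin> R" for x using h that by (auto simp: bij_betw_def)
  show thesis
  proof (rule that)
    show "inj_on \<rho> X"
      using h hB B(3) by (auto simp: \<rho>_def inj_on_def bij_betw_def)
    show "\<rho> ` X \<inter> Z \<subseteq> R" using hB B(3) by (auto simp: \<rho>_def)
  qed (simp add: \<rho>_def)
qed

text \<open>Zero-capacity dummy terminals bring the number of terminals to exactly \<open>j\<close>.\<close>

lemma sparsify_piece:
  fixes c :: "'v::infinite \<times> 'v \<Rightarrow> real" and Z :: "'v set"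
  assumes sp: "\<And>(H :: 'v network) R. terminal_network j H R \<Longrightarrow>
      \<exists>H'. flow_sparsifier q H R H' \<and> card (verts H') \<le> s"
    and j: "1 \<le> j" and X: "finite X" and R: "R \<subseteq> X" "card R \<le> j"
    and c: "symmetric_on X c" and Z: "finite Z"
  shows "\<exists>Y c'. finite Y \<and> Y \<inter> Z \<subseteq> R \<and> Y \<noteq> {} \<and> R \<subseteq> Y \<and> card Y \<le> s \<and> 1 \<le> q \<and> symmetric_on Y c' \<and>
     (\<forall>U \<delta> r. finite U \<longrightarrow> X \<union> Y \<subseteq> U \<longrightarrow> symmetric_on R \<delta> \<longrightarrow> 0 \<le> r \<longrightarrow> r < 1 \<longrightarrow>
        (routes U \<delta> c \<longrightarrow> routes U (\<lambda>p. r * \<delta> p) c') \<and>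
        (routes U \<delta> c' \<longrightarrow> routes U (\<lambda>p. r / q * \<delta> p) c))"
proof -
  obtain D :: "'v set" where D: "finite D" "card D = j - card R" "D \<inter> X = {}"
    using fresh_finite_set[OF X] by blast
  have fR: "finite R" using R X finite_subset by blast
  have cRD: "card (R \<union> D) = j" using D R fR card_Un_disjoint[of R D] by auto
  define H where "H = complete_network (X \<union> D) c"
  have ne: "X \<union> D \<noteq> {}" using cRD j R by auto
  have cXD: "symmetric_on (X \<union> D) c" using c by (rule symmetric_on_mono) auto
  have fXD: "finite (X \<union> D)" using X D by auto
  note H = complete_network[OF fXD ne cXD, folded H_def]
  have "terminal_network j H (R \<union> D)"
    using H cRD R by (auto simp: terminal_network_def)
  then obtain H' where H': "flow_sparsifier q H (R \<union> D) H'" "card (verts H') \<le> s" using sp by blast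
  have RDH: "R \<union> D \<subseteq> verts H" using H R by auto
  note sp' = H'(1)[unfolded flow_sparsifier_iff[OF H(1) RDH]]
  have q: "1 \<le> q" and nH': "network H'" and RDH': "R \<union> D \<subseteq> verts H'" using sp' by blast+
  note fH' = networkD(1)[OF nH']
  \<comment> \<open>Only \<open>R\<close> has to stay fixed; the dummies in \<open>D\<close> may be
    renamed like inner vertices.\<close>
  obtain \<rho> where \<rho>: "inj_on \<rho> (verts H')" "\<And>x. x \<in> R \<Longrightarrow> \<rho> x = x" "\<rho> ` verts H' \<inter> Z \<subseteq> R"
    using fresh_renaming[OF fH' _ Z, of R] RDH' by auto
  define Y where "Y = \<rho> ` verts H'"
  define \<sigma> where "\<sigma> = inv_into (verts H') \<rho>"
  define c' where "c' e = (if e \<in> Y \<times> Y then edge_capacity H' (\<sigma> (fst e), \<sigma> (snd e)) else 0)" for e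
  have bij: "bij_betw \<rho> (verts H') Y" using \<rho>(1) by (simp add: Y_def bij_betw_def)
  then have bij': "bij_betw \<sigma> Y (verts H')" unfolding \<sigma>_def by (rule bij_betw_inv_into)
  have \<sigma>\<rho>: "\<sigma> (\<rho> x) = x" if "x \<in> verts H'" for x
    unfolding \<sigma>_def using \<rho>(1) that by (rule inv_into_f_f)
  have \<rho>\<sigma>: "\<rho> (\<sigma> y) = y" if "y \<in> Y" for y
    unfolding \<sigma>_def using that by (simp add: Y_def f_inv_into_f)
  have c'\<rho>: "c' (\<rho> x, \<rho> y) = edge_capacity H' (x, y)" if "x \<in> verts H'" "y \<in> verts H'" for x y
    using that \<sigma>\<rho> by (auto simp: c'_def Y_def)
  note sH' = symmetric_on_edge_capacity[OF nH']
  have RY: "R \<subseteq> Y" using RDH' \<rho>(2) by (force simp: Y_def)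
  have sc': "symmetric_on Y c'"
    unfolding symmetric_on_def
  proof (intro conjI allI impI)
    show "0 \<le> c' e" for e using symmetric_onD(1)[OF sH'] by (simp add: c'_def)
    show "c' (x, y) = c' (y, x)" for x y
      using symmetric_onD(2)[OF sH'] by (auto simp: c'_def)
    show "x \<noteq> y" "x \<in> Y" "y \<in> Y" if "c' (x, y) \<noteq> 0" for x y
      using that symmetric_onD(3)[OF sH'] by (auto simp: c'_def split: if_splits)
  qed
  have \<delta>\<rho>: "\<delta> (\<rho> x, \<rho> y) = \<delta> (x, y)"
    if \<delta>: "symmetric_on R \<delta>" and xy: "x \<in> verts H'" "y \<in> verts H'" for \<delta> x y
  proof -
    \<comment> \<open>As an injection fixing \<open>R\<close>, \<open>\<rho>\<close> moves no other
      vertex into \<open>R\<close>, so weights that vanish off \<open>R\<close> are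
      preserved.\<close>
    have "\<rho> z \<in> R \<longleftrightarrow> z \<in> R" if "z \<in> verts H'" for z
      using \<rho>(1,2) that RDH' by (metis Un_subset_iff inj_onD subsetD)
    then show ?thesis
      using symmetric_on_eq_0[OF \<delta>] \<rho>(2) xy by (metis (no_types, lifting))
  qed
  have ren: "routes (verts H') \<delta> (edge_capacity H') \<longleftrightarrow> routes Y \<delta> c'" if \<delta>: "symmetric_on R \<delta>" for \<delta>
  proof
    show "routes Y \<delta> c'" if "routes (verts H') \<delta> (edge_capacity H')"
      by (rule routes_rename[OF bij that]) (use c'\<rho> \<delta>\<rho>[OF \<delta>] in auto)
    show "routes (verts H') \<delta> (edge_capacity H')" if "routes Y \<delta> c'"
    proof (rule routes_rename[OF bij' that])
      fix x y assume "x \<in> Y" "y \<in> Y"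
      then have "\<sigma> x \<in> verts H'" "\<sigma> y \<in> verts H'" using bij' by (auto simp: bij_betw_def)
      then show "\<delta> (\<sigma> x, \<sigma> y) = \<delta> (x, y)" "edge_capacity H' (\<sigma> x, \<sigma> y) = c' (x, y)"
        using \<delta>\<rho>[OF \<delta>, of "\<sigma> x" "\<sigma> y"] c'\<rho>[of "\<sigma> x" "\<sigma> y"] \<rho>\<sigma> \<open>x \<in> Y\<close> \<open>y \<in> Y\<close> by auto
    qed
  qed
  have main: "(routes U \<delta> c \<longrightarrow> routes U (\<lambda>p. r * \<delta> p) c') \<and>
        (routes U \<delta> c' \<longrightarrow> routes U (\<lambda>p. r / q * \<delta> p) c)"
    if U: "finite U" "X \<union> Y \<subseteq> U" and \<delta>: "symmetric_on R \<delta>" and r: "0 \<le> r" "r < 1" for U \<delta> r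
  proof -
    have \<delta>s: "symmetric_on R (\<lambda>p. a * \<delta> p)" if "0 \<le> a" for a
      using \<delta> that unfolding symmetric_on_def by auto
    have sup: "routes U \<epsilon> b \<longleftrightarrow> routes V \<epsilon> b"
      if "finite U" "V \<subseteq> U" "symmetric_on V b" "symmetric_on V \<epsilon>" for U V \<epsilon> b
      using that by (intro routes_superset_iff) (auto intro: symmetric_on_eq_0)
    have UX: "routes U (\<lambda>p. a * \<delta> p) c \<longleftrightarrow> routes (verts H) (\<lambda>p. a * \<delta> p) (edge_capacity H)"
      if a: "0 \<le> a" for a
      using sup[OF U(1) _ c symmetric_on_mono[OF \<delta>s[OF a] R(1)]] U(2)
        sup[OF fXD _ c symmetric_on_mono[OF \<delta>s[OF a] R(1)]] H(2,3) by simp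
    have UY: "routes U (\<lambda>p. a * \<delta> p) c' \<longleftrightarrow> routes (verts H') (\<lambda>p. a * \<delta> p) (edge_capacity H')"
      if a: "0 \<le> a" for a
      using sup[OF U(1) _ sc' symmetric_on_mono[OF \<delta>s[OF a] RY]] U(2) ren[OF \<delta>s[OF a]] by simp
    \<comment> \<open>Weights on \<open>R\<close> count as zero at the dummies, so the guarantee for
      \<open>R \<union> D\<close> applies.\<close>
    have \<delta>D: "symmetric_on (R \<union> D) \<delta>" using \<delta> by (rule symmetric_on_mono) auto
    note p = pair_demand_of_pair[OF \<delta>D]
    have "(routable H (R \<union> D) (of_pair \<delta>) \<longrightarrow> routable H' (R \<union> D) (\<lambda>p. r * of_pair \<delta> p)) \<and>
       (routable H' (R \<union> D) (of_pair \<delta>) \<longrightarrow> routable H (R \<union> D) (\<lambda>p. r / q * of_pair \<delta> p))"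
      using sp' p(2) r by blast
    then show ?thesis
      unfolding routable_iff_routes[OF H(1) RDH] routable_iff_routes[OF nH' RDH']
        pair_demand_scale p(1)
      using UX[of 1] UX[of "r / q"] UY[of 1] UY[of r] r q by simp
  qed
  have "card Y \<le> s" using H'(2) card_image_le[OF fH', of \<rho>] by (simp add: Y_def)
  moreover have "finite Y" "Y \<noteq> {}" using fH' RDH' ne cRD j by (auto simp: Y_def)
  ultimately show ?thesis
    using RY \<rho>(3) q sc' main unfolding Y_def[symmetric] by blast
qed

text \<open>The objects are chosen one after another, each avoiding \<open>Z\<close> and all earlier
  ones up to its own \<open>R i\<close>; hence the arbitrary finite \<open>Z'\<close> in the
  hypothesis.\<close>

lemma fresh_choice:
  assumes "finite A" "finite Z"
    and "\<And>i Z'. i \<in> A \<Longrightarrow> finite Z' \<Longrightarrow> \<exists>y. finite (V y) \<and> V y \<inter> Z' \<subseteq> R i \<and> P i y"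
    and "\<And>i. i \<in> A \<Longrightarrow> R i \<subseteq> Z"
  shows "\<exists>f. (\<forall>i\<in>A. finite (V (f i)) \<and> V (f i) \<inter> Z \<subseteq> R i \<and> P i (f i)) \<and>
      (\<forall>i\<in>A. \<forall>j\<in>A. i \<noteq> j \<longrightarrow> V (f i) \<inter> V (f j) \<subseteq> Z)"
  using assms
proof (induction A rule: finite_induct)
  case (insert i A)
  then obtain f where f: "\<forall>i\<in>A. finite (V (f i)) \<and> V (f i) \<inter> Z \<subseteq> R i \<and> P i (f i)"
    "\<forall>i\<in>A. \<forall>j\<in>A. i \<noteq> j \<longrightarrow> V (f i) \<inter> V (f j) \<subseteq> Z"
    by (metis insertCI)
  have "finite (Z \<union> (\<Union>i\<in>A. V (f i)))" using f insert.prems insert.hyps by blast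
  then obtain y where y: "finite (V y)" "V y \<inter> (Z \<union> (\<Union>i\<in>A. V (f i))) \<subseteq> R i" "P i y"
    using insert.prems(2)[of i] by blast
  define g where "g = f(i := y)"
  have g: "g i = y" "\<And>j. j \<in> A \<Longrightarrow> g j = f j" using insert.hyps by (auto simp: g_def)
  have Ri: "R i \<subseteq> Z" using insert.prems by blast
  have "V y \<inter> V (f j) \<subseteq> Z" if "j \<in> A" for j using y(2) Ri that by blast
  then have "\<forall>k\<in>insert i A. \<forall>j\<in>insert i A. k \<noteq> j \<longrightarrow> V (g k) \<inter> V (g j) \<subseteq> Z"
    using f(2) g by (metis inf_commute insert_iff)
  moreover have "\<forall>k\<in>insert i A. finite (V (g k)) \<and> V (g k) \<inter> Z \<subseteq> R k \<and> P k (g k)"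
    using f(1) y g by auto
  ultimately show ?case by blast
qed simp

text \<open>By \<open>XX\<close> and \<open>XT\<close>, a vertex of \<open>X i\<close> outside
  \<open>R i\<close> lies in no other piece and is no terminal, so it may be eliminated. The number
  of pieces enters the size but not the quality.\<close>

theorem flow_sparsifier_of_pieces:
  fixes G :: "'v::infinite network" and A :: "'i set"
  assumes sp: "\<And>(H :: 'v network) R. terminal_network j H R \<Longrightarrow>
      \<exists>H'. flow_sparsifier q H R H' \<and> card (verts H') \<le> s"
    and j: "1 \<le> j" and G: "network G" "T \<subseteq> verts G" and T: "T \<noteq> {}" "T \<subseteq> (\<Union>i\<in>A. R i)"
    and A: "finite A" and X: "\<And>i. i \<in> A \<Longrightarrow> X i \<subseteq> verts G"
    and R: "\<And>i. i \<in> A \<Longrightarrow> R i \<subseteq> X i" "\<And>i. i \<in> A \<Longrightarrow> card (R i) \<le> j"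
    and E: "\<And>e. e \<in> edges G \<Longrightarrow> \<exists>i\<in>A. e \<subseteq> X i"
    and XX: "\<And>i i'. i \<in> A \<Longrightarrow> i' \<in> A \<Longrightarrow> i \<noteq> i' \<Longrightarrow> X i \<inter> X i' \<subseteq> R i"
    and XT: "\<And>i. i \<in> A \<Longrightarrow> T \<inter> X i \<subseteq> R i"
  shows "\<exists>G'. flow_sparsifier q G T G' \<and> card (verts G') \<le> card A * s"
proof -
  define Z where "Z = verts G"
  note fG = networkD(1)[OF G(1)]
  \<comment> \<open>An edge within an overlap fits into several pieces; \<open>\<iota>\<close>
    assigns it to one, so that the \<open>c i\<close> add up to the capacities of
    \<open>G\<close>.\<close>
  obtain \<iota> where \<iota>: "\<And>e. e \<in> edges G \<Longrightarrow> \<iota> e \<in> A \<and> e \<subseteq> X (\<iota> e)" using E by metis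
  define c where "c i e = (if \<iota> {fst e, snd e} = i then edge_capacity G e else 0)" for i e
  note sG = symmetric_on_edge_capacity[OF G(1)]
  have c: "symmetric_on (X i) (c i)" for i
    unfolding symmetric_on_def
  proof (intro conjI allI impI)
    show "0 \<le> c i e" for e using symmetric_onD(1)[OF sG] by (simp add: c_def)
    show "c i (x, y) = c i (y, x)" for x y
      using symmetric_onD(2)[OF sG] by (simp add: c_def insert_commute)
    fix x y assume "c i (x, y) \<noteq> 0"
    then have ne: "edge_capacity G (x, y) \<noteq> 0" "\<iota> {x, y} = i" by (auto simp: c_def split: if_splits)
    then show "x \<noteq> y" using symmetric_onD(3)[OF sG] by metis
    show "x \<in> X i" "y \<in> X i"
      using ne \<iota>[of "{x, y}"] by (auto simp: edge_capacity_def split: if_splits)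
  qed
  have c_sum: "(\<Sum>i\<in>A. c i e) = edge_capacity G e" for e
  proof (cases "edge_capacity G e = 0")
    case True
    then show ?thesis by (auto simp: c_def intro: sum.neutral)
  next
    case False
    then have "\<iota> {fst e, snd e} \<in> A" using \<iota>[of "{fst e, snd e}"] by (auto simp: edge_capacity_def split: if_splits)
    then show ?thesis using A by (simp add: c_def)
  qed
  define P where "P i y \<longleftrightarrow> fst y \<noteq> {} \<and> R i \<subseteq> fst y \<and> card (fst y) \<le> s \<and> 1 \<le> q \<and> symmetric_on (fst y) (snd y) \<and>
     (\<forall>U \<delta> r. finite U \<longrightarrow> X i \<union> fst y \<subseteq> U \<longrightarrow> symmetric_on (R i) \<delta> \<longrightarrow> 0 \<le> r \<longrightarrow> r < 1 \<longrightarrow>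
        (routes U \<delta> (c i) \<longrightarrow> routes U (\<lambda>p. r * \<delta> p) (snd y)) \<and>
        (routes U \<delta> (snd y) \<longrightarrow> routes U (\<lambda>p. r / q * \<delta> p) (c i)))"
    for i and y :: "'v set \<times> ('v \<times> 'v \<Rightarrow> real)"
  have ex: "\<exists>y. finite (fst y) \<and> fst y \<inter> Z' \<subseteq> R i \<and> P i y" if "i \<in> A" "finite Z'" for i Z'
  proof -
    have "finite (X i)" using X[OF that(1)] fG finite_subset by blast
    then show ?thesis
      unfolding P_def split_paired_Ex fst_conv snd_conv
      using sp j R that c by (intro sparsify_piece)
  qed
  have RZ: "R i \<subseteq> Z" if "i \<in> A" for i using R(1) X that unfolding Z_def by blast
  obtain f where f: "\<forall>i\<in>A. finite (fst (f i)) \<and> fst (f i) \<inter> Z \<subseteq> R i \<and> P i (f i)"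
    and ff: "\<forall>i\<in>A. \<forall>j\<in>A. i \<noteq> j \<longrightarrow> fst (f i) \<inter> fst (f j) \<subseteq> Z"
    using fresh_choice[of A Z fst R P, OF A _ ex RZ] fG unfolding Z_def by blast
  define Y where "Y i = fst (f i)" for i
  define c' where "c' i = snd (f i)" for i
  have Y: "finite (Y i)" "Y i \<inter> Z \<subseteq> R i" "Y i \<noteq> {}" "R i \<subseteq> Y i" "card (Y i) \<le> s"
    "symmetric_on (Y i) (c' i)" and q: "1 \<le> q"
    if "i \<in> A" for i
    using f that unfolding P_def Y_def c'_def by auto
  have rc: "routes U \<delta> (c i) \<Longrightarrow> routes U (\<lambda>p. r * \<delta> p) (c' i)"
    "routes U \<delta> (c' i) \<Longrightarrow> routes U (\<lambda>p. r / q * \<delta> p) (c i)"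
    if "i \<in> A" "finite U" "X i \<union> Y i \<subseteq> U" "symmetric_on (R i) \<delta>" "0 \<le> r" "r < 1" for i U \<delta> r
    using f that unfolding P_def Y_def c'_def by blast+
  define N where "N = (\<Union>i\<in>A. Y i)"
  define C where "C e = (\<Sum>i\<in>A. c' i e)" for e
  obtain i0 where i0: "i0 \<in> A" using T by blast
  have fN: "finite N" using A Y(1) by (auto simp: N_def)
  have N: "N \<noteq> {}" "T \<subseteq> N" using Y(3)[OF i0] i0 Y(4) T by (auto simp: N_def) blast
  have C: "symmetric_on N C"
    unfolding symmetric_on_def
  proof (intro conjI allI impI)
    show "0 \<le> C e" for e using symmetric_onD(1)[OF Y(6)] by (simp add: C_def sum_nonneg)
    show "C (x, y) = C (y, x)" for x y
      using symmetric_onD(2)[OF Y(6)] by (simp add: C_def)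
    fix x y assume "C (x, y) \<noteq> 0"
    then obtain i where i: "i \<in> A" "c' i (x, y) \<noteq> 0" unfolding C_def by (meson sum.neutral)
    have "x \<noteq> y \<and> x \<in> Y i \<and> y \<in> Y i"
      using Y(6)[OF i(1)] i(2) unfolding symmetric_on_def by blast
    then show "x \<noteq> y" "x \<in> N" "y \<in> N" using i(1) by (auto simp: N_def)
  qed
  define G' where "G' = complete_network N C"
  note G' = complete_network[OF fN N(1) C, folded G'_def]
  define U where "U = verts G \<union> N"
  have U: "finite U" "verts G \<subseteq> U" "N \<subseteq> U" using fG fN by (auto simp: U_def)
  define B where "B = (\<Union>i\<in>A. R i)"
  have BZ: "B \<subseteq> Z" using RZ by (auto simp: B_def)
  \<comment> \<open>A vertex kept because it bounds another piece lies in both pieces, hence by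
    \<open>XX\<close> also bounds this one.\<close>
  have XB: "X i \<inter> B \<subseteq> R i" if "i \<in> A" for i
    using XX R(1) that by (auto simp: B_def) blast
  have YB: "Y i \<inter> B \<subseteq> R i" if "i \<in> A" for i using Y(2)[OF that] BZ by blast
  have YY: "Y i \<inter> Y i' \<subseteq> B" if "i \<in> A" "i' \<in> A" "i \<noteq> i'" for i i'
    using ff Y(2) that unfolding Y_def B_def by blast
  have XX': "X i \<inter> X i' \<subseteq> B" if "i \<in> A" "i' \<in> A" "i \<noteq> i'" for i i'
    using XX that unfolding B_def by blast
  have XYU: "X i \<subseteq> U" "Y i \<subseteq> U" "X i \<union> Y i \<subseteq> U" if "i \<in> A" for i
    using X[OF that] that by (auto simp: U_def N_def)
  have sup: "routes U \<epsilon> b \<longleftrightarrow> routes V \<epsilon> b"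
    if "V \<subseteq> U" "symmetric_on V b" "symmetric_on V \<epsilon>" for V \<epsilon> b
    using that by (intro routes_superset_iff[OF U(1)]) (auto intro: symmetric_on_eq_0)
  have "(routable G T d \<longrightarrow> routable G' T (\<lambda>p. r * d p)) \<and>
       (routable G' T d \<longrightarrow> routable G T (\<lambda>p. r / q * d p))"
    if d: "demand T d" and r: "0 \<le> r" "r < 1" for d r
  proof -
    define \<delta> where "\<delta> = pair_demand T d"
    have sd: "symmetric_on T \<delta>" unfolding \<delta>_def by (rule symmetric_on_pair_demand[OF d])
    have sds: "symmetric_on V (\<lambda>p. a * \<delta> p)" if "0 \<le> a" "T \<subseteq> V" for a V
      using symmetric_on_mono[OF sd that(2)] that(1) unfolding symmetric_on_def by auto
    have rG: "routable G T (\<lambda>p. a * d p) \<longleftrightarrow> routes U (\<lambda>p. a * \<delta> p) (\<lambda>e. \<Sum>i\<in>A. c i e)" if "0 \<le> a" for a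
      unfolding routable_iff_routes[OF G] pair_demand_scale c_sum
      using sup[OF U(2) sG sds[OF that G(2)]] by (simp add: \<delta>_def)
    have rG': "routable G' T (\<lambda>p. a * d p) \<longleftrightarrow> routes U (\<lambda>p. a * \<delta> p) (\<lambda>e. \<Sum>i\<in>A. c' i e)" if "0 \<le> a" for a
      using sup[OF U(3) C sds[OF that N(2)]] routable_iff_routes[OF G'(1), of T] G' N(2)
      by (simp add: pair_demand_scale \<delta>_def C_def[abs_def])
    \<comment> \<open>Both directions instantiate one lemma: here with loss \<open>r\<close>, then
      with \<open>X\<close>, \<open>c\<close> and \<open>Y\<close>, \<open>c'\<close> exchanged and
      loss \<open>r / q\<close>.\<close>
    have "routes U (\<lambda>p. r * \<delta> p) (\<lambda>e. \<Sum>i\<in>A. c' i e)" if "routes U \<delta> (\<lambda>e. \<Sum>i\<in>A. c i e)"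
      by (rule routes_sparsify_pieces[where X = X and R = R and Z = B, OF U(1) A that sd c XYU(1) XB _ XX' r(1)])
         (use T rc(1) U XYU r in \<open>auto simp: B_def\<close>)
    moreover have "routes U (\<lambda>p. r / q * \<delta> p) (\<lambda>e. \<Sum>i\<in>A. c i e)" if "routes U \<delta> (\<lambda>e. \<Sum>i\<in>A. c' i e)"
      by (rule routes_sparsify_pieces[where X = Y and R = R and Z = B, OF U(1) A that sd Y(6) XYU(2) YB _ YY])
         (use T rc(2) U XYU r q[OF i0] in \<open>auto simp: B_def\<close>)
    ultimately show ?thesis
      using rG[of 1] rG'[of 1] rG'[of r] rG[of "r / q"] r q[OF i0] by simp
  qed
  then have "flow_sparsifier q G T G'"
    unfolding flow_sparsifier_iff[OF G] using q[OF i0] G' N by simp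
  moreover have "card (verts G') \<le> card A * s"
  proof -
    have "card N \<le> (\<Sum>i\<in>A. card (Y i))" unfolding N_def by (rule card_UN_le[OF A])
    also have "\<dots> \<le> card A * s" using Y(5) sum_bounded_above[of A "\<lambda>i. card (Y i)" s] by simp
    finally show ?thesis using G' by simp
  qed
  ultimately show ?thesis by blast
qed

section \<open>Cutting a tree decomposition into pieces\<close>

text \<open>The end \<open>l\<close> of a longest path has no neighbour but its successor
  \<open>p\<close>: one off the path would prolong it, one further along would close a
  cycle.\<close>

lemma tree_leaf:
  assumes tree: "tree_graph I F" and I: "2 \<le> card I"
  obtains l p where "l \<in> I" "p \<in> I" "l \<noteq> p" "\<And>x. {l, x} \<in> F \<Longrightarrow> x = p"
    "tree_graph (I - {l}) (F \<inter> [I - {l}]\<^bsup>2\<^esup>)"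
proof -
  have fin: "finite I" and F: "F \<subseteq> [I]\<^bsup>2\<^esup>" and con: "connected_graph I F"
    and acyc: "\<nexists>xs. is_cycle F xs"
    using tree by (auto simp: tree_graph_def finite_graph_def)
  have edge: "x \<in> I \<and> y \<in> I \<and> x \<noteq> y" if "{x, y} \<in> F" for x y
    using that F doubleton_in_nsets2[of x y I] by blast
  define path where "path xs \<longleftrightarrow> distinct xs \<and> set xs \<subseteq> I \<and>
      (\<forall>i. Suc i < length xs \<longrightarrow> {xs ! i, xs ! Suc i} \<in> F)" for xs
  have len: "length xs \<le> card I" if "path xs" for xs
    using that fin card_mono distinct_card unfolding path_def by metis
  obtain u v where uv: "u \<in> I" "v \<in> I" "u \<noteq> v" using I card_le_Suc0_iff_eq[OF fin] by auto
  then have "(u, v) \<in> {(x, y). {x, y} \<in> F}\<^sup>*" using con by (auto simp: connected_graph_def)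
  then obtain z where z: "{u, z} \<in> F" using uv(3) by (auto elim: converse_rtranclE)
  have uz: "path [u, z]" using z edge[OF z] by (auto simp: path_def nth_Cons')
  define xs where "xs = arg_max length path"
  have xs: "path xs" and max: "\<And>ys. path ys \<Longrightarrow> length ys \<le> length xs"
    using arg_max_natI[of path "[u, z]" length "Suc (card I)"]
      arg_max_nat_le[of path _ length "Suc (card I)"] uz len
    unfolding xs_def by (force simp: less_Suc_eq_le)+
  have l2: "2 \<le> length xs" using max[OF uz] by simp
  define l where "l = xs ! 0"
  define p where "p = xs ! 1"
  have nb: "x = p" if x: "{l, x} \<in> F" for x
  proof (rule ccontr)
    assume "x \<noteq> p"
    have "x \<in> set xs"
    proof (rule ccontr)
      assume "x \<notin> set xs"
      moreover have "{(x # xs) ! i, (x # xs) ! Suc i} \<in> F" if "Suc i < length (x # xs)" for i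
        using that xs x by (cases i) (auto simp: path_def l_def insert_commute)
      ultimately have "path (x # xs)" using xs edge[OF x] by (auto simp: path_def)
      then show False using max by fastforce
    qed
    then obtain j where j: "j < length xs" "x = xs ! j" by (auto simp: in_set_conv_nth)
    have "j \<noteq> 0" using edge[OF x] j(2) unfolding l_def by metis
    moreover have "j \<noteq> 1" using \<open>x \<noteq> p\<close> j(2) unfolding p_def by metis
    ultimately have j2: "2 \<le> j" by simp
    \<comment> \<open>The path from \<open>l\<close> to \<open>x\<close> is closed by the edge
      \<open>{l, x}\<close>; \<open>2 \<le> j\<close> gives the three vertices that a cycle must
      have.\<close>
    define ys where "ys = take (Suc j) xs"
    have ly: "length ys = Suc j" using j by (simp add: ys_def)
    have "{ys ! i, ys ! (Suc i mod length ys)} \<in> F" if i: "i < length ys" for i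
    proof (cases "i = j")
      case True
      then show ?thesis using x j ly by (simp add: ys_def l_def insert_commute)
    next
      case False
      then have "Suc i < length ys" using i ly by simp
      then show ?thesis using xs j ly by (auto simp: ys_def path_def)
    qed
    then have "is_cycle F ys" using ly j2 xs by (auto simp: is_cycle_def ys_def path_def)
    then show False using acyc by blast
  qed
  have lp: "{l, p} \<in> F" using xs l2 by (auto simp: path_def l_def p_def)
  define I' where "I' = I - {l}"
  define F' where "F' = F \<inter> [I']\<^bsup>2\<^esup>"
  \<comment> \<open>Folding \<open>l\<close> onto \<open>p\<close> maps walks to walks that avoid
    \<open>l\<close>, so deleting \<open>l\<close> preserves connectedness.\<close>
  define \<phi> where "\<phi> x = (if x = l then p else x)" for x
  have \<phi>: "(\<phi> x, \<phi> y) \<in> {(x, y). {x, y} \<in> F'}\<^sup>*" if "(x, y) \<in> {(x, y). {x, y} \<in> F}\<^sup>*" for x y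
    using that
  proof (induction rule: rtrancl_induct)
    case (step y w)
    then have yw: "{y, w} \<in> F" by simp
    have "\<phi> y = \<phi> w \<or> {\<phi> y, \<phi> w} \<in> F'"
      using yw nb[of w] nb[of y] edge[OF yw]
      by (auto simp: \<phi>_def F'_def I'_def doubleton_in_nsets2 insert_commute)
    then show ?case using step.IH by (auto intro: rtrancl_into_rtrancl)
  qed simp
  have "connected_graph I' F'"
  proof -
    have "(x, y) \<in> {(x, y). {x, y} \<in> F'}\<^sup>*" if "x \<in> I'" "y \<in> I'" for x y
    proof -
      have "(x, y) \<in> {(x, y). {x, y} \<in> F}\<^sup>*"
        using con that by (auto simp: connected_graph_def I'_def)
      from \<phi>[OF this] show ?thesis using that by (simp add: \<phi>_def I'_def)
    qed
    moreover have "p \<in> I'" using edge[OF lp] by (auto simp: I'_def)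
    ultimately show ?thesis by (auto simp: connected_graph_def)
  qed
  moreover have "\<nexists>xs. is_cycle F' xs" using acyc by (auto simp: is_cycle_def F'_def)
  ultimately have "tree_graph I' F'"
    using fin by (auto simp: tree_graph_def finite_graph_def I'_def F'_def)
  then show thesis
    using that[of l p] edge[OF lp] nb unfolding I'_def F'_def by blast
qed

text \<open>On each component of \<open>I - M\<close>, \<open>gate\<close> is constant and contains
  the marks inside and the labels \<open>h j\<close> of adjacent nodes \<open>j\<close> of
  \<open>M\<close>. Labels and marks share a type because both will become vertex sets: bags and
  singletons of terminals.\<close>

definition tree_gating ::
    "('a \<Rightarrow> 'g) \<Rightarrow> 'a set \<Rightarrow> 'a set set \<Rightarrow> ('a \<Rightarrow> 'g set) \<Rightarrow> 'a set \<Rightarrow> ('a \<Rightarrow> 'g set) \<Rightarrow> bool" where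
  "tree_gating h I F a M gate \<longleftrightarrow> M \<subseteq> I \<and>
     (\<forall>i\<in>I - M. card (gate i) \<le> 2 \<and> a i \<subseteq> gate i \<and> gate i \<subseteq> h ` M \<union> (\<Union>i\<in>I. a i)) \<and>
     (\<forall>i\<in>I - M. \<forall>j\<in>I. {i, j} \<in> F \<longrightarrow> (if j \<in> M then h j \<in> gate i else gate j = gate i))"

lemma tree_gatingD:
  assumes "tree_gating h I F a M gate"
  shows "M \<subseteq> I"
    and "\<And>i. i \<in> I - M \<Longrightarrow> card (gate i) \<le> 2 \<and> a i \<subseteq> gate i \<and> gate i \<subseteq> h ` M \<union> (\<Union>i\<in>I. a i)"
    and "\<And>i j. i \<in> I - M \<Longrightarrow> j \<in> I \<Longrightarrow> {i, j} \<in> F \<Longrightarrow>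
      if j \<in> M then h j \<in> gate i else gate j = gate i"
  using assms unfolding tree_gating_def by blast+

text \<open>
  The set \<open>M\<close> consists of the branching nodes of the subtree spanned by the marks \<open>a\<close>. It is found by
  removing leaves: a leaf that carries a single mark passes it on to its neighbour, a leaf \<open>l\<close> that
  carries more becomes a member of \<open>M\<close> and leaves the mark \<open>h l\<close> behind.
\<close>

lemma tree_gates:
  fixes a :: "'a \<Rightarrow> 'g set" and h :: "'a \<Rightarrow> 'g"
  assumes "tree_graph I F" "\<And>i. i \<in> I \<Longrightarrow> finite (a i)"
  shows "\<exists>M gate. card M \<le> (\<Sum>i\<in>I. card (a i)) - 1 \<and> tree_gating h I F a M gate"
  using assms
proof (induction "card I" arbitrary: I F a rule: less_induct)
  case less
  have fin: "finite I" and F: "F \<subseteq> [I]\<^bsup>2\<^esup>" and ne: "I \<noteq> {}"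
    using less.prems(1) by (auto simp: tree_graph_def finite_graph_def connected_graph_def)
  show ?case
  proof (cases "2 \<le> card I")
    case False
    then have "card I = 1" using ne fin by (metis One_nat_def card_0_eq less_2_cases not_le)
    then obtain i where i: "I = {i}" by (auto simp: card_1_singleton_iff)
    have Fe: "{x, y} \<notin> F" if "x \<in> I" "y \<in> I" for x y
      using F doubleton_in_nsets2[of x y I] that i by blast
    show ?thesis
    \<comment> \<open>A node with at most two marks is a part of its own; with three or more it goes
      into \<open>M\<close>, for which the bound leaves room.\<close>
    proof (cases "card (a i) \<le> 2")
      case True
      then show ?thesis
        using Fe i by (intro exI[of _ "{}"] exI[of _ a]) (auto simp: tree_gating_def)
    next
      case False
      then show ?thesis using Fe i by (intro exI[of _ "{i}"] exI[of _ a]) (auto simp: tree_gating_def)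
    qed
  next
    case True
    obtain l p where l: "l \<in> I" and p: "p \<in> I" and lp: "l \<noteq> p"
      and nb: "\<And>x. {l, x} \<in> F \<Longrightarrow> x = p"
      and tree': "tree_graph (I - {l}) (F \<inter> [I - {l}]\<^bsup>2\<^esup>)"
      using tree_leaf[OF less.prems(1) True] by blast
    have nb': "x = p" if "{x, l} \<in> F" for x using nb[of x] that by (simp add: insert_commute)
    have lt: "card (I - {l}) < card I" using l fin by (simp add: card_gt_0_iff ne)
    have F': "{x, y} \<in> F \<inter> [I - {l}]\<^bsup>2\<^esup>" if "{x, y} \<in> F" "x \<noteq> l" "y \<noteq> l" for x y
      using that F doubleton_in_nsets2[of x y I] doubleton_in_nsets2[of x y "I - {l}"] by blast
    define N where "N = (\<Sum>i\<in>I - {l} - {p}. card (a i))"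
    have N: "(\<Sum>i\<in>I. card (a i)) = card (a l) + (card (a p) + N)"
      using sum.remove[OF fin l, of "\<lambda>i. card (a i)"]
        sum.remove[of "I - {l}" p "\<lambda>i. card (a i)"] fin p lp by (simp add: N_def)
    have N': "(\<Sum>i\<in>I - {l}. card ((a(p := b)) i)) = card b + N" for b
      using sum.remove[of "I - {l}" p "\<lambda>i. card ((a(p := b)) i)"] fin p lp by (simp add: N_def)
    note fa = less.prems(2)
    show ?thesis
    proof (cases "card (a l) \<le> 1")
      case True
      define a' where "a' = a(p := a p \<union> a l)"
      have fa': "finite (a' i)" if "i \<in> I - {l}" for i using fa that l by (auto simp: a'_def)
      obtain M gate where cM: "card M \<le> (\<Sum>i\<in>I - {l}. card (a' i)) - 1"
        and gM: "tree_gating h (I - {l}) (F \<inter> [I - {l}]\<^bsup>2\<^esup>) a' M gate"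
        using less.hyps[OF lt tree', of a'] fa' by blast
      note M = tree_gatingD(1)[OF gM] and g = tree_gatingD(2)[OF gM] and adj = tree_gatingD(3)[OF gM]
      \<comment> \<open>If \<open>p\<close> is in \<open>M\<close>, the leaf is a part of its own,
        attached to \<open>h p\<close> and at most one mark; this explains the threshold 1.
        Otherwise it joins the part of \<open>p\<close>, whose gate contains any mark passed
        on.\<close>
      define gate' where "gate' = gate(l := if p \<in> M then insert (h p) (a l) else gate p)"
      have sub: "(\<Union>i\<in>I - {l}. a' i) \<subseteq> (\<Union>i\<in>I. a i)" using l p by (auto simp: a'_def split: if_splits)
      have "card M \<le> (\<Sum>i\<in>I. card (a i)) - 1"
        using cM card_Un_le[of "a p" "a l"] unfolding a'_def N' N by linarith
      moreover have "card (gate' i) \<le> 2 \<and> a i \<subseteq> gate' i \<and> gate' i \<subseteq> h ` M \<union> (\<Union>i\<in>I. a i)"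
        if i: "i \<in> I - M" for i
      proof (cases "i = l")
        case il: True
        show ?thesis
        proof (cases "p \<in> M")
          case pM: True
          have "card (insert (h p) (a l)) \<le> 2"
            using True fa[OF l] card_insert_le_m1[of 2 "a l" "h p"] by simp
          then show ?thesis using il pM l by (auto simp: gate'_def)
        next
          case pM: False
          then show ?thesis using il g[of p] sub p lp by (auto simp: gate'_def a'_def)
        qed
      next
        case False
        have i': "i \<in> I - {l} - M" and aa': "a i \<subseteq> a' i" using i False by (auto simp: a'_def)
        have eq: "gate' i = gate i" using False by (simp add: gate'_def)
        show ?thesis
          unfolding eq using g[OF i'] aa' Un_mono[OF order_refl sub, of "h ` M"] by (meson order_trans)
      qed
      moreover have "if j \<in> M then h j \<in> gate' i else gate' j = gate' i"
        if ij: "i \<in> I - M" "j \<in> I" "{i, j} \<in> F" for i j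
      proof -
        consider "i = l" | "i \<noteq> l" "j = l" | "i \<noteq> l" "j \<noteq> l" by blast
        then show ?thesis
        proof cases
          case 1
          then show ?thesis using nb ij lp by (auto simp: gate'_def)
        next
          case 2
          then show ?thesis using nb' ij lp M by (auto simp: gate'_def)
        next
          case 3
          then show ?thesis using adj[of i j] ij F' by (auto simp: gate'_def)
        qed
      qed
      moreover have "M \<subseteq> I" using M by blast
      ultimately show ?thesis unfolding tree_gating_def by blast
    next
      case False
      define a' where "a' = a(p := insert (h l) (a p))"
      have fa': "finite (a' i)" if "i \<in> I - {l}" for i using fa that p by (auto simp: a'_def)
      obtain M gate where cM: "card M \<le> (\<Sum>i\<in>I - {l}. card (a' i)) - 1"
        and gM: "tree_gating h (I - {l}) (F \<inter> [I - {l}]\<^bsup>2\<^esup>) a' M gate"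
        using less.hyps[OF lt tree', of a'] fa' by blast
      note M = tree_gatingD(1)[OF gM] and g = tree_gatingD(2)[OF gM] and adj = tree_gatingD(3)[OF gM]
      have sub: "(\<Union>i\<in>I - {l}. a' i) \<subseteq> insert (h l) (\<Union>i\<in>I. a i)"
        using p by (auto simp: a'_def split: if_splits)
      \<comment> \<open>Two or more marks give way to the one mark \<open>h l\<close>, so the total
        drops and pays for adding \<open>l\<close> to \<open>M\<close>. Positivity of the new total
        keeps the truncated \<open>- 1\<close> exact.\<close>
      have "0 < card (insert (h l) (a p))" using fa[OF p] by (simp add: card_gt_0_iff)
      moreover have "card (insert (h l) (a p)) \<le> Suc (card (a p))" by (rule card_insert_le_m1) auto
      moreover have "card (insert l M) \<le> Suc (card M)" by (rule card_insert_le_m1) auto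
      ultimately have "card (insert l M) \<le> (\<Sum>i\<in>I. card (a i)) - 1"
        using cM False unfolding a'_def N' N by linarith
      moreover have "card (gate i) \<le> 2 \<and> a i \<subseteq> gate i \<and> gate i \<subseteq> h ` insert l M \<union> (\<Union>i\<in>I. a i)"
        if i: "i \<in> I - insert l M" for i
      proof -
        have i': "i \<in> I - {l} - M" and aa': "a i \<subseteq> a' i" using i by (auto simp: a'_def)
        have "h ` M \<union> (\<Union>i\<in>I - {l}. a' i) \<subseteq> h ` insert l M \<union> (\<Union>i\<in>I. a i)" using sub by auto
        then show ?thesis using g[OF i'] aa' by (meson order_trans)
      qed
      moreover have "if j \<in> insert l M then h j \<in> gate i else gate j = gate i"
        if ij: "i \<in> I - insert l M" "j \<in> I" "{i, j} \<in> F" for i j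
      proof (cases "j = l")
        case True
        then have "i = p" using nb' ij by blast
        then have "h l \<in> gate i" using g[of i] ij by (auto simp: a'_def)
        then show ?thesis using True by simp
      next
        case False
        then show ?thesis using adj[of i j] ij F' by auto
      qed
      moreover have "insert l M \<subseteq> I" using M l by blast
      ultimately show ?thesis unfolding tree_gating_def by blast
    qed
  qed
qed

text \<open>A vertex in a bag of a node with gate \<open>P\<close>, but outside
  \<open>\<Union>P\<close>, occurs only at nodes with gate \<open>P\<close>: the nodes containing it
  are connected, and a step into \<open>M\<close> would place it in a bag that belongs to
  \<open>P\<close>.\<close>

lemma tree_decomposition_pieces:
  assumes td: "tree_decomposition V E I F B" and V: "finite V" and T: "T \<subseteq> V" "card T = k" "2 \<le> k"
    and b: "\<And>i. i \<in> I \<Longrightarrow> card (B i) \<le> b" "1 \<le> b"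
  obtains A :: "'v set set set" and X where "finite A" "card A \<le> k ^ 4"
    and "\<And>P. P \<in> A \<Longrightarrow> X P \<subseteq> V" "\<And>P. P \<in> A \<Longrightarrow> \<Union>P \<subseteq> X P" "\<And>P. P \<in> A \<Longrightarrow> card (\<Union>P) \<le> 2 * b"
    and "\<And>P. P \<in> A \<Longrightarrow> T \<inter> X P \<subseteq> \<Union>P" "\<And>P Q. P \<in> A \<Longrightarrow> Q \<in> A \<Longrightarrow> P \<noteq> Q \<Longrightarrow> X P \<inter> X Q \<subseteq> \<Union>P"
    and "\<And>e. e \<in> E \<Longrightarrow> \<exists>P\<in>A. e \<subseteq> X P" "T \<subseteq> (\<Union>P\<in>A. \<Union>P)"
proof -
  have tree: "tree_graph I F" and BV: "(\<Union>i\<in>I. B i) = V" and EB: "\<And>e. e \<in> E \<Longrightarrow> \<exists>i\<in>I. e \<subseteq> B i"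
    and con: "\<And>v. v \<in> V \<Longrightarrow> connected_graph {i \<in> I. v \<in> B i} (F \<inter> [{i \<in> I. v \<in> B i}]\<^bsup>2\<^esup>)"
    using td by (auto simp: tree_decomposition_def)
  have fin: "finite I" using tree by (simp add: tree_graph_def finite_graph_def)
  have fT: "finite T" using T V finite_subset by blast
  obtain node where node: "\<And>t. t \<in> T \<Longrightarrow> node t \<in> I \<and> t \<in> B (node t)"
    using BV T(1) by (metis UN_iff subsetD)
  \<comment> \<open>A terminal may lie in many bags but marks a single node, so there are
    \<open>k\<close> marks; as singletons they can be collected with bags.\<close>
  define a where "a i = (\<lambda>t. {t}) ` {t \<in> T. node t = i}" for i
  have fa: "finite (a i)" for i using fT by (simp add: a_def)
  have "(\<Sum>i\<in>I. card (a i)) = (\<Sum>i\<in>I. \<Sum>t | t \<in> T \<and> node t = i. 1)"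
    by (simp add: a_def card_image)
  also have "\<dots> = k" using sum.group[OF fT fin, of node "\<lambda>_. 1::nat"] node T by auto
  finally have ak: "(\<Sum>i\<in>I. card (a i)) = k" .
  obtain M gate where cM: "card M \<le> k - 1" and gate: "tree_gating B I F a M gate"
    using tree_gates[of I F a B, OF tree fa] unfolding ak by blast
  note M = tree_gatingD(1)[OF gate] and g = tree_gatingD(2)[OF gate] and adj = tree_gatingD(3)[OF gate]
  have fM: "finite M" using M fin finite_subset by blast
  define \<Gamma> where "\<Gamma> = B ` M \<union> (\<lambda>t. {t}) ` T"
  have f\<Gamma>: "finite \<Gamma>" using fM fT by (simp add: \<Gamma>_def)
  have a\<Gamma>: "(\<Union>i\<in>I. a i) \<subseteq> (\<lambda>t. {t}) ` T" by (auto simp: a_def)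
  define A where "A = {P. P \<subseteq> \<Gamma> \<and> card P \<le> 2}"
  define X where "X P = \<Union>P \<union> (\<Union>i\<in>{i \<in> I - M. gate i = P}. B i)" for P
  have gA: "gate i \<in> A" if "i \<in> I - M" for i
    using g[OF that] Un_mono[OF order_refl a\<Gamma>, of "B ` M"]
    unfolding A_def \<Gamma>_def by (blast intro: order_trans)
  have sA: "{x} \<in> A" if "x \<in> \<Gamma>" for x using that by (simp add: A_def)
  have \<Gamma>V: "x \<subseteq> V" if "x \<in> \<Gamma>" for x using that BV M T by (auto simp: \<Gamma>_def)
  have \<Gamma>b: "card x \<le> b" if "x \<in> \<Gamma>" for x using that b M by (auto simp: \<Gamma>_def)
  have stay: "j \<in> I - M \<and> gate j = P"
    if i: "i \<in> I - M" "gate i = P" and v: "v \<in> B i" "v \<notin> \<Union>P" and j: "j \<in> I" "v \<in> B j" for i j P v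
  proof -
    let ?J = "{i \<in> I. v \<in> B i}"
    have "v \<in> V" using BV i v by blast
    then have "(i, j) \<in> {(x, y). {x, y} \<in> F \<inter> [?J]\<^bsup>2\<^esup>}\<^sup>*"
      using con[of v] i v j by (auto simp: connected_graph_def)
    then show ?thesis
    proof (induction rule: rtrancl_induct)
      case base
      then show ?case using i by blast
    next
      case (step x y)
      then have xy: "{x, y} \<in> F" "y \<in> I" "v \<in> B y" by (auto simp: doubleton_in_nsets2)
      have "if y \<in> M then B y \<in> gate x else gate y = gate x"
        using adj[of x y] step.IH xy by blast
      then show ?case using step.IH xy v(2) by (auto split: if_splits)
    qed
  qed
  have T\<Gamma>: "v \<notin> T" if "i \<in> I - M" "gate i = P" "v \<in> B i" "v \<notin> \<Union>P" for i P v
  proof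
    assume v: "v \<in> T"
    then have n: "node v \<in> I - M \<and> gate (node v) = P" using stay[OF that] node by blast
    have "{v} \<in> a (node v)" using v by (simp add: a_def)
    then have "{v} \<in> P" using g[of "node v"] n by blast
    then show False using that(4) by blast
  qed
  show thesis
  proof (rule that)
    show "finite A" using f\<Gamma> by (simp add: A_def)
    show "card A \<le> k ^ 4"
    proof -
      \<comment> \<open>Pairs with equal components account for the one-element sets.\<close>
      have "A \<subseteq> insert {} ((\<lambda>(x, y). {x, y}) ` (\<Gamma> \<times> \<Gamma>))"
      proof
        fix P assume P: "P \<in> A"
        then have "finite P" "card P \<le> 2" "P \<subseteq> \<Gamma>" using f\<Gamma> finite_subset by (auto simp: A_def)
        then have "P = {} \<or> (\<exists>x y. P = {x, y})"
          by (metis One_nat_def card_0_eq card_1_singletonE card_2_iff insert_absorb2 le_SucE le_zero_eq numeral_2_eq_2)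
        then show "P \<in> insert {} ((\<lambda>(x, y). {x, y}) ` (\<Gamma> \<times> \<Gamma>))" using \<open>P \<subseteq> \<Gamma>\<close> by auto
      qed
      then have "card A \<le> card (insert {} ((\<lambda>(x, y). {x, y}) ` (\<Gamma> \<times> \<Gamma>)))"
        using f\<Gamma> by (intro card_mono) auto
      also have "\<dots> \<le> Suc (card ((\<lambda>(x, y). {x, y}) ` (\<Gamma> \<times> \<Gamma>)))" by (rule card_insert_le_m1) auto
      also have "\<dots> \<le> Suc (card \<Gamma> * card \<Gamma>)"
        using card_image_le[of "\<Gamma> \<times> \<Gamma>" "\<lambda>(x, y). {x, y}"] f\<Gamma> by (simp add: card_cartesian_product)
      \<comment> \<open>At most \<open>k - 1\<close> bags and \<open>k\<close> singletons are
        labels. The extra 1 for the empty set is absorbed on passing from \<open>2 * k - 1\<close>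
        to \<open>2 * k\<close>.\<close>
      also have "\<dots> \<le> Suc ((2 * k - 1) * (2 * k - 1))"
      proof -
        have "card \<Gamma> \<le> card (B ` M) + card ((\<lambda>t. {t}) ` T)" unfolding \<Gamma>_def by (rule card_Un_le)
        also have "\<dots> \<le> (k - 1) + k"
          using cM card_image_le[OF fM, of B] card_image_le[OF fT, of "\<lambda>t. {t}"] T(2) by linarith
        finally show ?thesis using T(3) by (intro Suc_le_mono[THEN iffD2] mult_le_mono) auto
      qed
      also have "\<dots> \<le> (2 * k) * (2 * k)"
      proof -
        obtain m where m: "2 * k = Suc m" using T(3) by (metis Suc_pred mult_pos_pos pos2 less_le_trans)
        show ?thesis unfolding m by simp
      qed
      also have "\<dots> = (2 * 2) * (k * k)" by simp
      also have "\<dots> \<le> (k * k) * (k * k)" using T(3) by (intro mult_le_mono) auto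
      also have "\<dots> = k ^ 4" by (simp add: power4_eq_xxxx)
      finally show ?thesis .
    qed
    show "X P \<subseteq> V" if "P \<in> A" for P
      using that \<Gamma>V BV by (auto simp: A_def X_def)
    show "\<Union>P \<subseteq> X P" for P by (auto simp: X_def)
    show "card (\<Union>P) \<le> 2 * b" if "P \<in> A" for P
    proof -
      have "card (\<Union>P) \<le> (\<Sum>x\<in>P. card x)" by (rule card_Union_le_sum_card)
      also have "\<dots> \<le> card P * b"
        using that \<Gamma>b sum_bounded_above[of P card b] by (auto simp: A_def)
      also have "\<dots> \<le> 2 * b" using that by (intro mult_le_mono1) (simp add: A_def)
      finally show ?thesis .
    qed
    show "T \<inter> X P \<subseteq> \<Union>P" for P
      unfolding X_def using T\<Gamma> by blast
    show "X P \<inter> X Q \<subseteq> \<Union>P" if "P \<in> A" "Q \<in> A" "P \<noteq> Q" for P Q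
    proof (rule subsetI, rule ccontr)
      fix v assume v: "v \<in> X P \<inter> X Q" "v \<notin> \<Union>P"
      then obtain i where i: "i \<in> I - M" "gate i = P" "v \<in> B i" by (auto simp: X_def)
      note st = stay[OF i v(2)]
      \<comment> \<open>No node containing \<open>v\<close> has gate \<open>Q\<close>, so only a
        label can put \<open>v\<close> into \<open>X Q\<close>. A bag of \<open>M\<close> is
        excluded by \<open>st\<close>, a terminal by \<open>T\<Gamma>\<close>.\<close>
      have "v \<in> \<Union>Q" using v(1) st that(3) by (auto simp: X_def)
      then obtain x where x: "x \<in> Q" "v \<in> x" by blast
      then have "x \<in> \<Gamma>" using that(2) by (auto simp: A_def)
      then consider m where "m \<in> M" "v \<in> B m" | "v \<in> T" using x(2) by (auto simp: \<Gamma>_def)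
      then show False using st M T\<Gamma>[OF i v(2)] by cases blast+
    qed
    show "\<exists>P\<in>A. e \<subseteq> X P" if e: "e \<in> E" for e
    proof -
      obtain i where i: "i \<in> I" "e \<subseteq> B i" using EB[OF e] by blast
      show ?thesis
      proof (cases "i \<in> M")
        case True
        then have "{B i} \<in> A" by (intro sA) (simp add: \<Gamma>_def)
        then show ?thesis using i by (auto simp: X_def)
      next
        case False
        then show ?thesis using i gA[of i] by (auto simp: X_def intro!: bexI[of _ "gate i"])
      qed
    qed
    show "T \<subseteq> (\<Union>P\<in>A. \<Union>P)"
    proof
      fix t assume "t \<in> T"
      then have "{{t}} \<in> A" by (intro sA) (simp add: \<Gamma>_def)
      then show "t \<in> (\<Union>P\<in>A. \<Union>P)" by blast
    qed
  qed
qed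

theorem theorem7p7:
  fixes q :: "nat \<Rightarrow> real" and S :: "nat \<Rightarrow> nat"
    and G :: "'v::infinite network" and T :: "'v set" and k w :: nat
  assumes sparsifiers: "\<And>j (H :: 'v network) R. 1 \<le> j \<Longrightarrow> terminal_network j H R \<Longrightarrow>
      \<exists>H'. flow_sparsifier (q j) H R H' \<and> card (verts H') \<le> S j"
    and k: "1 \<le> k" and G: "terminal_network k G T"
    and w: "1 \<le> w" and tw: "treewidth (verts G) (edges G) = w"
  shows "\<exists>G'. flow_sparsifier (q (6 * w)) G T G' \<and> card (verts G') \<le> k ^ 4 * S (6 * w)"
proof -
  have nG: "network G" and TG: "T \<subseteq> verts G" and kT: "card T = k"
    using G by (auto simp: terminal_network_def)
  have T0: "T \<noteq> {}" using kT k by auto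
  have j: "1 \<le> 6 * w" using w by simp
  note sp = sparsifiers[OF j]
  show ?thesis
  proof (cases "k \<le> 6 * w")
    case True
    \<comment> \<open>A single piece with boundary \<open>T\<close>, whose \<open>k\<close>
      terminals are padded to \<open>6 * w\<close>.\<close>
    have "\<exists>G'. flow_sparsifier (q (6 * w)) G T G' \<and> card (verts G') \<le> card {()} * S (6 * w)"
    proof (rule flow_sparsifier_of_pieces[where X = "\<lambda>_. verts G" and R = "\<lambda>_. T", OF sp j nG TG T0])
      show "\<exists>i\<in>{()}. e \<subseteq> verts G" if "e \<in> edges G" for e
        using networkD(2)[OF nG] that by (auto simp: nsets_def)
    qed (use TG kT True in auto)
    moreover have "card {()} * S (6 * w) \<le> k ^ 4 * S (6 * w)" using k by (intro mult_le_mono1) simp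
    ultimately show ?thesis using le_trans by blast
  next
    case False
    have "finite_graph (verts G) (edges G)" using nG by (simp add: network_def)
    then have "\<exists>w I F B. tree_decomposition (verts G) (edges G) I F B \<and> decomposition_width I B = w"
      using trivial_tree_decomposition by blast
    from LeastI_ex[OF this] obtain I F B where
      td: "tree_decomposition (verts G) (edges G) I F B" and width: "decomposition_width I B = w"
      using tw unfolding treewidth_def by auto
    have "finite I" using td by (simp add: tree_decomposition_def tree_graph_def finite_graph_def)
    then have "card (B i) \<le> (MAX i\<in>I. card (B i))" if "i \<in> I" for i
      using that by (intro Max_ge) auto
    \<comment> \<open>The width is defined by truncated subtraction, so only this upper bound is
      read off.\<close>
    then have "card (B i) \<le> w + 1" if "i \<in> I" for i
      using width that unfolding decomposition_width_def by fastforce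
    then have b: "card (B i) \<le> 3 * w" if "i \<in> I" for i using w that by force
    have k2: "2 \<le> k" and b1: "1 \<le> 3 * w" using False w by auto
    obtain A :: "'v set set set" and X where A: "finite A" "card A \<le> k ^ 4"
      and X: "\<And>P. P \<in> A \<Longrightarrow> X P \<subseteq> verts G" "\<And>P. P \<in> A \<Longrightarrow> \<Union>P \<subseteq> X P"
        "\<And>P. P \<in> A \<Longrightarrow> card (\<Union>P) \<le> 2 * (3 * w)" "\<And>P. P \<in> A \<Longrightarrow> T \<inter> X P \<subseteq> \<Union>P"
        "\<And>P Q. P \<in> A \<Longrightarrow> Q \<in> A \<Longrightarrow> P \<noteq> Q \<Longrightarrow> X P \<inter> X Q \<subseteq> \<Union>P"
      and E: "\<And>e. e \<in> edges G \<Longrightarrow> \<exists>P\<in>A. e \<subseteq> X P" and TA: "T \<subseteq> (\<Union>P\<in>A. \<Union>P)"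
      by (rule tree_decomposition_pieces[OF td networkD(1)[OF nG] TG kT k2 b b1]) blast+
    have "\<exists>G'. flow_sparsifier (q (6 * w)) G T G' \<and> card (verts G') \<le> card A * S (6 * w)"
      by (rule flow_sparsifier_of_pieces[where X = X and R = "\<lambda>P. \<Union>P", OF sp j nG TG T0 TA A(1)])
         (use X E in auto)
    moreover have "card A * S (6 * w) \<le> k ^ 4 * S (6 * w)" using A(2) by (rule mult_le_mono1)
    ultimately show ?thesis using le_trans by blast
  qed
qed

end
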